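(* Let $p_1$ be a mesh pattern whose leftmost bottom box $(0,0)$ is not shaded, and let $p$ be the mesh pattern obtained from the mesh pattern $(12,\{(0,1),(0,2),(1,0),(1,1),(1,2),(2,0),(2,1)\})$ by inserting $p_1$ in the box $(2,2)$. Then $$A_p(x)=\frac{(1+x)F(x)+x^2F(x)A_{p_1}(x)}{1+x+x^2F(x)}.$$
   Context: $S_n$ is the set of permutations of $\{1,\dots,n\}$, $n\ge 0$ ($S_0$ consists of the empty permutation). A mesh pattern of length $k$ is a pair $(\tau,R)$ with $\tau\in S_k$ and $R\subseteq\{0,\dots,k\}\times\{0,\dots,k\}$ (the shaded boxes). Given $\pi=\pi_1\cdots\pi_n\in S_n$ and positions $i_1<\dots<i_k$, let $v_1<\dots<v_k$ be the values $\pi_{i_1},\dots,\pi_{i_k}$ sorted increasingly, and put $i_0=v_0=0$, $i_{k+1}=v_{k+1}=n+1$. The box $(r,s)$ contains the elements $\pi_j$ with $i_r<j<i_{r+1}$ and $v_s<\pi_j<v_{s+1}$. The subsequence $\pi_{i_1}\cdots\pi_{i_k}$ is an occurrence of $(\tau,R)$ if it is order-isomorphic to $\tau$ and every box in $R$ contains no element of $\pi$. The empty pattern ($k=0$, $R=\emptyset$) is allowed and has exactly one occurrence in every permutation. Insertion of patterns: if a mesh pattern is inserted in an unshaded box of a base mesh pattern, an occurrence of the resulting mesh pattern in $\pi$ consists of an occurrence of the base pattern in $\pi$ together with an occurrence of the inserted pattern in the permutation order-isomorphic to the sequence of all elements of $\pi$ lying in that box (other unshaded boxes are unrestricted). For a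 mesh pattern $p$, $A_p(x)=\sum_{n\ge 0}x^n\,|\{\pi\in S_n: \pi\text{ has no occurrence of }p\}|$, and $F(x)=\sum_{n\ge0}n!\,x^n$. All are formal power series. *)

theory Defs
  imports "HOL-Combinatorics.Multiset_Permutations"
    "HOL-Computational_Algebra.Formal_Power_Series"
begin

text \<open>
  Permutations are lists in one-line notation. As positions and values are counted from 1,
  the entry \<open>\<pi>\<^sub>j\<close> is \<open>\<pi> ! (j - 1)\<close>.
\<close>

definition perms :: "nat \<Rightarrow> nat list set" where
  "perms n = permutations_of_set {1..n}"

definition entry :: "nat list \<Rightarrow> nat \<Rightarrow> nat" where
  "entry \<pi> j = \<pi> ! (j - 1)"

definition order_isomorphic :: "nat list \<Rightarrow> nat list \<Rightarrow> bool" where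
  "order_isomorphic xs ys \<longleftrightarrow> length xs = length ys \<and>
     (\<forall>i<length xs. \<forall>j<length xs. xs ! i < xs ! j \<longleftrightarrow> ys ! i < ys ! j)"

text \<open>For distinct entries, the permutation order-isomorphic to the given sequence.\<close>

definition standardize :: "nat list \<Rightarrow> nat list" where
  "standardize xs = map (\<lambda>x. card {y \<in> set xs. y \<le> x}) xs"

datatype mesh = Mesh (underlying: "nat list") (shading: "(nat \<times> nat) set")

definition mesh_pattern :: "mesh \<Rightarrow> bool" where
  "mesh_pattern p \<longleftrightarrow> (let k = length (underlying p) in
     underlying p \<in> perms k \<and> shading p \<subseteq> {0..k} \<times> {0..k})"

text \<open>
  In the following, \<open>js\<close> is the list of positions \<open>i\<^sub>1 < \<dots> < i\<^sub>k\<close>. The lists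
  \<open>0 # js @ [n + 1]\<close> and \<open>0 # sort (map (entry \<pi>) js) @ [n + 1]\<close> are
  \<open>i\<^sub>0, \<dots>, i\<^bsub>k+1\<^esub>\<close> and \<open>v\<^sub>0, \<dots>, v\<^bsub>k+1\<^esub>\<close>.
\<close>

definition box_positions :: "nat list \<Rightarrow> nat list \<Rightarrow> nat \<Rightarrow> nat \<Rightarrow> nat list" where
  "box_positions \<pi> js r s = (let n = length \<pi>;
       I = 0 # js @ [n + 1]; V = 0 # sort (map (entry \<pi>) js) @ [n + 1]
     in filter (\<lambda>j. I ! r < j \<and> j < I ! (r + 1) \<and> V ! s < entry \<pi> j \<and> entry \<pi> j < V ! (s + 1))
          [1..<n + 1])"

definition box_elements :: "nat list \<Rightarrow> nat list \<Rightarrow> nat \<Rightarrow> nat \<Rightarrow> nat list" where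
  "box_elements \<pi> js r s = map (entry \<pi>) (box_positions \<pi> js r s)"

definition occurrence :: "mesh \<Rightarrow> nat list \<Rightarrow> nat list \<Rightarrow> bool" where
  "occurrence p \<pi> js \<longleftrightarrow>
     sorted_wrt (<) js \<and> set js \<subseteq> {1..length \<pi>} \<and>
     order_isomorphic (map (entry \<pi>) js) (underlying p) \<and>
     (\<forall>(r, s) \<in> shading p. box_elements \<pi> js r s = [])"

text \<open>
  The mesh pattern obtained by inserting \<open>q\<close> of length \<open>l\<close> in the unshaded box \<open>(a, b)\<close> of \<open>p\<close>:
  the letters of \<open>q\<close> come after the first \<open>a\<close> letters of \<open>p\<close> and take the values
  \<open>b + 1, \<dots>, b + l\<close>. Column \<open>c\<close> of the result lies in column \<open>coarsen a l c\<close> of \<open>p\<close>,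
  and likewise for rows. A box of the result is shaded if it lies in a shaded box of \<open>p\<close>,
  or if it lies in the box \<open>(a, b)\<close> of \<open>p\<close> and is shaded in the copy of \<open>q\<close> placed there.
  The lemma \<open>occurrence_insert_mesh\<close> below gives the occurrences of the result.
\<close>

definition coarsen :: "nat \<Rightarrow> nat \<Rightarrow> nat \<Rightarrow> nat" where
  "coarsen a l c = (if c < a then c else if c \<le> a + l then a else c - l)"

definition insert_mesh :: "mesh \<Rightarrow> nat \<times> nat \<Rightarrow> mesh \<Rightarrow> mesh" where
  "insert_mesh p box q = (let (a, b) = box; k = length (underlying p); l = length (underlying q);
       \<tau> = map (\<lambda>v. if v \<le> b then v else v + l) (underlying p)
     in Mesh (take a \<tau> @ map (\<lambda>v. v + b) (underlying q) @ drop a \<tau>)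
          {(r, s). r \<le> k + l \<and> s \<le> k + l \<and>
             ((coarsen a l r, coarsen b l s) \<in> shading p \<or>
              (coarsen a l r, coarsen b l s) = (a, b) \<and> (r - a, s - b) \<in> shading q)})"

definition avoiders_fps :: "mesh \<Rightarrow> rat fps" where
  "avoiders_fps p = Abs_fps (\<lambda>n. of_nat (card {\<pi> \<in> perms n. \<not> (\<exists>js. occurrence p \<pi> js)}))"

definition fact_fps :: "rat fps" where
  "fact_fps = Abs_fps (\<lambda>n. fact n)"

text \<open>
  What follows only serves to prove \<open>occurrence_insert_mesh\<close>. An element at a position \<open>j\<close>
  outside an occurrence lies in the box given by the numbers of elements of the occurrence to its
  left and below it.
\<close>

definition cnt :: "nat set \<Rightarrow> nat \<Rightarrow> nat" where
  "cnt X x = card {y \<in> X. y < x}"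

lemma cnt_image:
  assumes "strict_mono_on A f" "X \<subseteq> A" "x \<in> A"
  shows "cnt (f ` X) (f x) = cnt X x"
proof -
  have "{y \<in> f ` X. y < f x} = f ` {y \<in> X. y < x}"
    using assms by (auto simp: strict_mono_on_less subset_iff)
  moreover have "inj_on f {y \<in> X. y < x}"
    using strict_mono_on_imp_inj_on[OF assms(1)] by (rule inj_on_subset) (use assms in auto)
  ultimately show ?thesis by (simp add: cnt_def card_image)
qed

lemma cnt_union:
  assumes "finite X" "finite Y" "X \<inter> Y = {}" "\<And>y. y \<in> Y \<Longrightarrow> cnt X y = a" "x \<notin> Y"
  shows "cnt (X \<union> Y) x = cnt X x + cnt Y x" "coarsen a (card Y) (cnt (X \<union> Y) x) = cnt X x"
proof -
  have "{y \<in> X \<union> Y. y < x} = {y \<in> X. y < x} \<union> {y \<in> Y. y < x}" by auto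
  then show *: "cnt (X \<union> Y) x = cnt X x + cnt Y x"
    unfolding cnt_def using assms(1-3) by (simp add: card_Un_disjoint disjoint_iff)
  have mono: "cnt X u \<le> cnt X v" if "u \<le> v" for u v
    unfolding cnt_def by (rule card_mono) (use assms(1) that in auto)
  have le: "cnt Y x \<le> card Y"
    unfolding cnt_def by (rule card_mono) (use assms(2) in auto)
  consider "cnt X x < a" | "cnt X x = a" | "cnt X x > a" by linarith
  then show "coarsen a (card Y) (cnt (X \<union> Y) x) = cnt X x"
  proof cases
    case 1
    have "\<not> y < x" if "y \<in> Y" for y
      using assms(4)[OF that] mono[of y x] 1 by auto
    then have "{y \<in> Y. y < x} = {}" by blast
    then have "cnt Y x = 0" by (simp add: cnt_def)
    with 1 * show ?thesis by (simp add: coarsen_def)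
  next
    case 2
    with * le show ?thesis by (simp add: coarsen_def)
  next
    case 3
    have "y < x" if "y \<in> Y" for y
      using assms(4)[OF that] mono[of x y] 3 by (meson leD leI)
    then have "{y \<in> Y. y < x} = Y" by blast
    then have "cnt Y x = card Y" by (simp add: cnt_def)
    with 3 * show ?thesis by (simp add: coarsen_def)
  qed
qed

lemma gap_iff_cnt:
  assumes "sorted_wrt (<) L" "set L \<subseteq> {1..n}" "x \<in> {1..n}" "r \<le> length L"
  shows "(0 # L @ [n + 1]) ! r < x \<and> x < (0 # L @ [n + 1]) ! (r + 1) \<longleftrightarrow>
    x \<notin> set L \<and> cnt (set L) x = r"
  (is "?l r \<longleftrightarrow> _")
proof -
  let ?W = "0 # L @ [n + 1]"
  have sW: "sorted_wrt (<) ?W"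
    using assms(1,2) by (auto simp: sorted_wrt_append subset_iff less_Suc_eq_le Suc_le_eq)
  have dir: "x \<notin> set L \<and> cnt (set L) x = r" if "?l r" "r \<le> length L" for r
  proof -
    have up: "?W ! i \<le> ?W ! r" if "i \<le> r" for i
      using sorted_wrt_nth_less[OF sW, of i r] that \<open>r \<le> length L\<close> by (cases "i = r") auto
    have dn: "?W ! i \<ge> ?W ! (r + 1)" if "i \<ge> r + 1" "i < length ?W" for i
      using sorted_wrt_nth_less[OF sW, of "r + 1" i] that by (cases "i = r + 1") auto
    have small: "L ! i < x \<longleftrightarrow> i < r" "L ! i \<noteq> x" if "i < length L" for i
    proof -
      have eq: "L ! i = ?W ! (i + 1)" using that by (simp add: nth_append)
      show "L ! i < x \<longleftrightarrow> i < r" using up[of "i + 1"] dn[of "i + 1"] \<open>?l r\<close> that unfolding eq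
        by (cases "i < r") auto
      show "L ! i \<noteq> x" using up[of "i + 1"] dn[of "i + 1"] \<open>?l r\<close> that unfolding eq
        by (cases "i < r") auto
    qed
    have "{y \<in> set L. y < x} = set (take r L)"
    proof (rule set_eqI)
      fix y
      have "y \<in> set (take r L) \<longleftrightarrow> (\<exists>i<length L. i < r \<and> L ! i = y)"
        using \<open>r \<le> length L\<close> by (auto simp: in_set_conv_nth) (metis order_less_le_trans)
      also have "\<dots> \<longleftrightarrow> (\<exists>i<length L. L ! i = y \<and> y < x)"
        using small(1) by blast
      also have "\<dots> \<longleftrightarrow> y \<in> {y \<in> set L. y < x}"
        by (auto simp: in_set_conv_nth)
      finally show "y \<in> {y \<in> set L. y < x} \<longleftrightarrow> y \<in> set (take r L)" by blast
    qed
    moreover have "distinct L" using assms(1) strict_sorted_iff by blast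
    ultimately have "cnt (set L) x = r"
      using \<open>r \<le> length L\<close> by (simp add: cnt_def distinct_card)
    with small show ?thesis by (auto simp: in_set_conv_nth)
  qed
  show ?thesis
  proof
    assume "?l r" then show "x \<notin> set L \<and> cnt (set L) x = r" using dir assms(4) by blast
  next
    assume R: "x \<notin> set L \<and> cnt (set L) x = r"
    define m where "m = (GREATEST i. i \<le> length L \<and> ?W ! i < x)"
    have ex: "0 \<le> length L \<and> ?W ! 0 < x" using assms(3) by auto
    have m: "m \<le> length L \<and> ?W ! m < x"
      unfolding m_def by (rule GreatestI_nat[where k = 0 and b = "length L"]) (use ex in auto)
    have "x < ?W ! (m + 1)"
    proof (cases "m = length L")
      case True
      then show ?thesis using assms(3) by simp
    next
      case False
      then have "\<not> ?W ! (m + 1) < x"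
        using Greatest_le_nat[of "\<lambda>i. i \<le> length L \<and> ?W ! i < x" "m + 1" "length L"] m
        unfolding m_def[symmetric] by auto
      moreover have "?W ! (m + 1) \<in> set L" using False m by (simp add: nth_append)
      ultimately show ?thesis using R by (metis linorder_neqE_nat)
    qed
    with m have "?l m" by blast
    with dir[of m] m R show "?l r" by blast
  qed
qed

lemma order_isomorphic_iff:
  assumes "distinct xs"
  shows "order_isomorphic xs ys \<longleftrightarrow> (\<exists>f. strict_mono_on (set xs) f \<and> map f xs = ys)"
proof
  assume oi: "order_isomorphic xs ys"
  define f where "f x = the (map_of (zip xs ys) x)" for x
  have len: "length xs = length ys" using oi by (simp add: order_isomorphic_def)
  have f: "f (xs ! i) = ys ! i" if "i < length xs" for i
    using that len assms by (simp add: f_def map_of_zip_nth)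
  have "map f xs = ys" using f len by (intro nth_equalityI) auto
  moreover have "strict_mono_on (set xs) f"
    using oi f by (auto simp: strict_mono_on_def in_set_conv_nth order_isomorphic_def)
  ultimately show "\<exists>f. strict_mono_on (set xs) f \<and> map f xs = ys" by blast
next
  assume "\<exists>f. strict_mono_on (set xs) f \<and> map f xs = ys"
  then show "order_isomorphic xs ys"
    by (auto simp: order_isomorphic_def strict_mono_on_less)
qed

lemma permsD:
  assumes "\<pi> \<in> perms n"
  shows "length \<pi> = n" "distinct \<pi>" "set \<pi> = {1..n}"
    "inj_on (entry \<pi>) {1..n}" "entry \<pi> ` {1..n} = {1..n}" "map (entry \<pi>) [1..<n + 1] = \<pi>"
proof -
  show d: "distinct \<pi>" and s: "set \<pi> = {1..n}"
    using assms by (auto simp: perms_def permutations_of_set_def)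
  show l: "length \<pi> = n" using d s distinct_card by fastforce
  show m: "map (entry \<pi>) [1..<n + 1] = \<pi>"
    using l by (intro nth_equalityI) (auto simp: entry_def simp del: upt_Suc)
  have [simp]: "set [1..<n + 1] = {1..n}" by auto
  show "entry \<pi> ` {1..n} = {1..n}" using s m by (metis \<open>set [1..<n + 1] = {1..n}\<close> list.set_map)
  show "inj_on (entry \<pi>) {1..n}" using d m by (metis \<open>set [1..<n + 1] = {1..n}\<close> distinct_map)
qed

lemma set_box_positions:
  assumes "\<pi> \<in> perms n" "sorted_wrt (<) js" "set js \<subseteq> {1..n}" "r \<le> length js" "s \<le> length js"
  shows "set (box_positions \<pi> js r s) = {j \<in> {1..n} - set js.
    cnt (set js) j = r \<and> cnt (entry \<pi> ` set js) (entry \<pi> j) = s}"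
proof -
  note P = permsD[OF assms(1)]
  let ?V = "sort (map (entry \<pi>) js)"
  have "distinct js" using assms(2) strict_sorted_iff by blast
  then have "distinct (map (entry \<pi>) js)"
    using P(4) assms(3) by (simp add: distinct_map inj_on_subset)
  then have V: "sorted_wrt (<) ?V" by (simp add: strict_sorted_iff)
  have V': "set ?V = entry \<pi> ` set js" by simp
  have sub: "set ?V \<subseteq> {1..n}" unfolding V' using P(5) assms(3) by blast
  have 1: "j \<in> set (box_positions \<pi> js r s) \<longleftrightarrow> j \<in> {1..n} \<and> (j \<notin> set js \<and> cnt (set js) j = r) \<and>
    (entry \<pi> j \<notin> set ?V \<and> cnt (set ?V) (entry \<pi> j) = s)" for j
  proof (cases "j \<in> {1..n}")
    case True
    then have e: "entry \<pi> j \<in> {1..n}" using P(5) by blast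
    show ?thesis
      using gap_iff_cnt[OF assms(2,3) True assms(4)] gap_iff_cnt[OF V sub e, of s] assms(5) True P(1)
      by (auto simp: box_positions_def Let_def simp del: upt_Suc)
  next
    case False
    then show ?thesis using P(1) by (auto simp: box_positions_def Let_def simp del: upt_Suc)
  qed
  have 2: "entry \<pi> j \<in> entry \<pi> ` set js \<longleftrightarrow> j \<in> set js" if "j \<in> {1..n}" for j
    using P(4) assms(3) that by (meson inj_on_image_mem_iff)
  show ?thesis
  proof (rule set_eqI)
    fix j
    show "j \<in> set (box_positions \<pi> js r s) \<longleftrightarrow> j \<in> {j \<in> {1..n} - set js.
      cnt (set js) j = r \<and> cnt (entry \<pi> ` set js) (entry \<pi> j) = s}"
      using 1[of j] 2[of j] unfolding V' by (cases "j \<in> {1..n}") auto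
  qed
qed

lemma occurrence_iff:
  assumes "\<pi> \<in> perms n" "mesh_pattern p"
  shows "occurrence p \<pi> js \<longleftrightarrow> sorted_wrt (<) js \<and> set js \<subseteq> {1..n} \<and>
     order_isomorphic (map (entry \<pi>) js) (underlying p) \<and>
     (\<forall>j \<in> {1..n} - set js. (cnt (set js) j, cnt (entry \<pi> ` set js) (entry \<pi> j)) \<notin> shading p)"
proof -
  note n = permsD(1)[OF assms(1)]
  have "(\<forall>(r, s) \<in> shading p. box_elements \<pi> js r s = []) \<longleftrightarrow>
    (\<forall>j \<in> {1..n} - set js. (cnt (set js) j, cnt (entry \<pi> ` set js) (entry \<pi> j)) \<notin> shading p)"
    if js: "sorted_wrt (<) js" "set js \<subseteq> {1..n}"
      and oi: "order_isomorphic (map (entry \<pi>) js) (underlying p)"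
  proof -
    have len: "length js = length (underlying p)" using oi by (simp add: order_isomorphic_def)
    have "box_elements \<pi> js r s = [] \<longleftrightarrow> (\<forall>j \<in> {1..n} - set js.
      \<not> (cnt (set js) j = r \<and> cnt (entry \<pi> ` set js) (entry \<pi> j) = s))"
      if rs: "(r, s) \<in> shading p" for r s
    proof -
      have "r \<le> length js" "s \<le> length js"
        using assms(2) rs len by (auto simp: mesh_pattern_def Let_def)
      from set_box_positions[OF assms(1) js this] 
      have "set (box_positions \<pi> js r s) = {} \<longleftrightarrow> (\<forall>j \<in> {1..n} - set js.
        \<not> (cnt (set js) j = r \<and> cnt (entry \<pi> ` set js) (entry \<pi> j) = s))"
        by (simp only: Collect_empty_eq) blast
      then show ?thesis by (simp add: box_elements_def)
    qed
    then show ?thesis by fast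
  qed
  then show ?thesis unfolding occurrence_def n by argo
qed

lemma standardize_perms:
  assumes "distinct xs"
  defines "s \<equiv> \<lambda>x. card {y \<in> set xs. y \<le> x}"
  shows "strict_mono_on (set xs) s" "standardize xs = map s xs" "standardize xs \<in> perms (length xs)"
proof -
  show m: "strict_mono_on (set xs) s"
    unfolding strict_mono_on_def s_def
  proof (intro allI impI)
    fix u v assume "u \<in> set xs \<and> v \<in> set xs \<and> u < v"
    then have "v \<in> {y \<in> set xs. y \<le> v} - {y \<in> set xs. y \<le> u}"
      "{y \<in> set xs. y \<le> u} \<subseteq> {y \<in> set xs. y \<le> v}" by auto
    then show "card {y \<in> set xs. y \<le> u} < card {y \<in> set xs. y \<le> v}"
      by (intro psubset_card_mono) (simp, blast)
  qed
  show e: "standardize xs = map s xs" by (simp add: standardize_def s_def)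
  have "s ` set xs \<subseteq> {1..length xs}"
  proof
    fix t assume "t \<in> s ` set xs"
    then obtain x where x: "x \<in> set xs" "t = s x" by auto
    have "card {x} \<le> s x" unfolding s_def by (rule card_mono) (use x in auto)
    moreover have "s x \<le> card (set xs)" unfolding s_def by (rule card_mono) auto
    ultimately show "t \<in> {1..length xs}" using x(2) distinct_card[OF assms(1)] by simp
  qed
  moreover have "card (s ` set xs) = length xs"
    using strict_mono_on_imp_inj_on[OF m] assms(1) by (simp add: card_image distinct_card)
  ultimately have "s ` set xs = {1..length xs}" by (intro card_subset_eq) simp_all
  then show "standardize xs \<in> perms (length xs)"
    unfolding e perms_def permutations_of_set_def
    using strict_mono_on_imp_inj_on[OF m] assms(1) by (simp add: distinct_map)
qed

lemma order_isomorphic_map: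
  assumes "strict_mono_on A s" "set xs \<subseteq> A"
  shows "order_isomorphic (map s xs) ys \<longleftrightarrow> order_isomorphic xs ys"
proof -
  have "map s xs ! i < map s xs ! j \<longleftrightarrow> xs ! i < xs ! j" if "i < length xs" "j < length xs" for i j
    using that assms by (auto simp: strict_mono_on_less subset_iff)
  then show ?thesis by (auto simp: order_isomorphic_def)
qed

lemma sorted_wrt_map_strict_mono:
  fixes f :: "nat \<Rightarrow> nat"
  assumes "strict_mono_on A f" "set xs \<subseteq> A"
  shows "sorted_wrt (<) (map f xs) \<longleftrightarrow> sorted_wrt (<) xs"
  using assms(2) by (induction xs) (auto simp: strict_mono_on_less[OF assms(1)] subset_iff)

lemma occurrence_standardize:
  fixes B ks :: "nat list"
  assumes "\<pi> \<in> perms n" "mesh_pattern q" "sorted_wrt (<) B" "set B \<subseteq> {1..n}"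
    "set ks \<subseteq> {1..length B}"
  defines "Q \<equiv> (\<lambda>i. B ! (i - 1)) ` set ks"
  shows "occurrence q (standardize (map (entry \<pi>) B)) ks \<longleftrightarrow>
    sorted_wrt (<) (map (\<lambda>i. B ! (i - 1)) ks) \<and>
    order_isomorphic (map (entry \<pi>) (map (\<lambda>i. B ! (i - 1)) ks)) (underlying q) \<and>
    (\<forall>j \<in> set B - Q. (cnt Q j, cnt (entry \<pi> ` Q) (entry \<pi> j)) \<notin> shading q)"
proof -
  define \<beta> where "\<beta> = (\<lambda>i. B ! (i - 1))"
  define e where "e = entry \<pi>"
  define m where "m = length B"
  define s where "s = (\<lambda>x. card {y \<in> set (map e B). y \<le> x})"
  define \<sigma> where "\<sigma> = standardize (map e B)"
  have Q: "Q = \<beta> ` set ks" by (simp add: Q_def \<beta>_def)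
  have ks: "set ks \<subseteq> {1..m}" using assms(5) by (simp add: m_def)
  have "distinct B" using assms(3) strict_sorted_iff by blast
  then have d: "distinct (map e B)"
    using permsD(4)[OF assms(1)] assms(4) unfolding e_def by (simp add: distinct_map inj_on_subset)
  note S = standardize_perms[OF d, folded s_def \<sigma>_def]
  have \<sigma>: "\<sigma> \<in> perms m" using S(3) by (simp add: m_def)
  have \<beta>: "strict_mono_on {1..m} \<beta>"
    unfolding strict_mono_on_def \<beta>_def m_def
    using sorted_wrt_nth_less[OF assms(3)] by auto
  have "{1..m} = Suc ` {0..<m}"
    unfolding image_Suc_atLeastLessThan by auto
  then have "\<beta> ` {1..m} = (\<lambda>i. B ! i) ` {0..<m}"
    by (simp only: \<beta>_def image_image diff_Suc_1)
  then have \<beta>B: "\<beta> ` {1..m} = set B"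
    by (auto simp: m_def set_conv_nth)
  have \<sigma>e: "entry \<sigma> i = s (e (\<beta> i))" if "i \<in> {1..m}" for i
    using that unfolding entry_def S(2) \<beta>_def m_def by auto
  have S1: "strict_mono_on (e ` set B) s" using S(1) by simp
  have me: "map (entry \<sigma>) ks = map s (map e (map \<beta> ks))"
    using \<sigma>e ks by auto
  have A: "order_isomorphic (map (entry \<sigma>) ks) (underlying q) \<longleftrightarrow>
      order_isomorphic (map e (map \<beta> ks)) (underlying q)"
    unfolding me by (rule order_isomorphic_map[OF S1]) (use ks \<beta>B in auto)
  have B: "sorted_wrt (<) (map \<beta> ks) \<longleftrightarrow> sorted_wrt (<) ks"
    by (rule sorted_wrt_map_strict_mono[OF \<beta> ks])
  have cI: "cnt (set ks) i = cnt Q (\<beta> i)" if "i \<in> {1..m}" for i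
    unfolding Q using cnt_image[OF \<beta> ks that] by simp
  have cV: "cnt (entry \<sigma> ` set ks) (entry \<sigma> i) = cnt (e ` Q) (e (\<beta> i))" if "i \<in> {1..m}" for i
  proof -
    have "entry \<sigma> ` set ks = s ` (e ` Q)"
      unfolding Q image_image by (rule image_cong) (use \<sigma>e ks in auto)
    moreover have "cnt (s ` (e ` Q)) (s (e (\<beta> i))) = cnt (e ` Q) (e (\<beta> i))"
      by (rule cnt_image[OF S1]) (use that \<beta>B ks Q in auto)
    ultimately show ?thesis using \<sigma>e[OF that] by simp
  qed
  have "set B - Q = \<beta> ` ({1..m} - set ks)"
    unfolding Q \<beta>B[symmetric]
    using inj_on_image_set_diff[OF strict_mono_on_imp_inj_on[OF \<beta>], of "{1..m}" "set ks"] ks by auto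
  then have C: "(\<forall>i \<in> {1..m} - set ks. (cnt (set ks) i, cnt (entry \<sigma> ` set ks) (entry \<sigma> i)) \<notin> shading q)
    \<longleftrightarrow> (\<forall>j \<in> set B - Q. (cnt Q j, cnt (e ` Q) (e j)) \<notin> shading q)"
    using cI cV by simp
  show ?thesis
    unfolding occurrence_iff[OF \<sigma>[unfolded \<sigma>_def e_def] assms(2)]
    using A B C ks unfolding \<sigma>_def e_def \<beta>_def by blast
qed

lemma insert_mesh_shading:
  assumes "\<pi> \<in> perms n" "J \<subseteq> {1..n}" "Q \<subseteq> {1..n}" "J \<inter> Q = {}"
    and box: "\<And>x. x \<in> Q \<Longrightarrow> cnt J x = a" "\<And>x. x \<in> Q \<Longrightarrow> cnt (entry \<pi> ` J) (entry \<pi> x) = b"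
    and "card J = length (underlying p)" "card Q = length (underlying q)" "(a, b) \<notin> shading p"
  shows "(\<forall>j \<in> {1..n} - (J \<union> Q). (cnt (J \<union> Q) j, cnt (entry \<pi> ` (J \<union> Q)) (entry \<pi> j))
      \<notin> shading (insert_mesh p (a, b) q)) \<longleftrightarrow>
    (\<forall>j \<in> {1..n} - J. (cnt J j, cnt (entry \<pi> ` J) (entry \<pi> j)) \<notin> shading p) \<and>
    (\<forall>j \<in> {j \<in> {1..n} - J. cnt J j = a \<and> cnt (entry \<pi> ` J) (entry \<pi> j) = b} - Q.
      (cnt Q j, cnt (entry \<pi> ` Q) (entry \<pi> j)) \<notin> shading q)"
proof -
  let ?e = "entry \<pi>" and ?k = "length (underlying p)" and ?l = "length (underlying q)"
  have inj: "inj_on ?e {1..n}" by (rule permsD(4)[OF assms(1)])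
  have fin: "finite J" "finite Q" using assms(2,3) finite_subset by blast+
  have cQ: "card (?e ` Q) = ?l" and cJ: "card (?e ` J) = ?k"
    using assms(2,3,7,8) inj by (auto simp: card_image inj_on_subset)
  have dis: "?e ` J \<inter> ?e ` Q = {}"
    using inj_on_image_Int[OF inj assms(2,3)] assms(4) by simp
  have key: "(cnt (J \<union> Q) j, cnt (?e ` (J \<union> Q)) (?e j)) \<notin> shading (insert_mesh p (a, b) q) \<longleftrightarrow>
    (cnt J j, cnt (?e ` J) (?e j)) \<notin> shading p \<and>
    (cnt J j = a \<and> cnt (?e ` J) (?e j) = b \<longrightarrow> (cnt Q j, cnt (?e ` Q) (?e j)) \<notin> shading q)"
    if j: "j \<in> {1..n} - (J \<union> Q)" for j
  proof -
    have "?e j \<notin> ?e ` Q" using inj j assms(3) by (simp add: inj_on_image_mem_iff)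
    have bV: "cnt (?e ` J) y = b" if "y \<in> ?e ` Q" for y
      using box(2) that by blast
    have V: "cnt (?e ` (J \<union> Q)) (?e j) = cnt (?e ` J) (?e j) + cnt (?e ` Q) (?e j)"
      "coarsen b ?l (cnt (?e ` (J \<union> Q)) (?e j)) = cnt (?e ` J) (?e j)"
      using cnt_union[OF finite_imageI[OF fin(1)] finite_imageI[OF fin(2)] dis bV \<open>?e j \<notin> ?e ` Q\<close>]
      unfolding image_Un cQ by simp_all
    have I: "cnt (J \<union> Q) j = cnt J j + cnt Q j" "coarsen a ?l (cnt (J \<union> Q) j) = cnt J j"
      using cnt_union[OF fin assms(4) box(1), of j] j assms(8) by auto
    have le: "cnt X x \<le> card X" if "finite X" for X x
      unfolding cnt_def by (rule card_mono) (use that in auto)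
    have "cnt (J \<union> Q) j \<le> ?k + ?l"
      using le[OF fin(1), of j] le[OF fin(2), of j] I(1) assms(7,8) by linarith
    moreover have "cnt (?e ` (J \<union> Q)) (?e j) \<le> ?k + ?l"
      using le[of "?e ` J" "?e j"] le[of "?e ` Q" "?e j"] fin V(1) cQ cJ by simp
    ultimately have "(cnt (J \<union> Q) j, cnt (?e ` (J \<union> Q)) (?e j)) \<in> shading (insert_mesh p (a, b) q) \<longleftrightarrow>
      (cnt J j, cnt (?e ` J) (?e j)) \<in> shading p \<or> (cnt J j, cnt (?e ` J) (?e j)) = (a, b) \<and>
      (cnt (J \<union> Q) j - a, cnt (?e ` (J \<union> Q)) (?e j) - b) \<in> shading q"
      using I(2) V(2) by (simp add: insert_mesh_def Let_def)
    then show ?thesis using I(1) V(1) by auto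
  qed
  have Qp: "(cnt J j, cnt (?e ` J) (?e j)) \<notin> shading p" if "j \<in> Q" for j
    using box[OF that] assms(9) by simp
  have "(\<forall>j \<in> {1..n} - J. (cnt J j, cnt (?e ` J) (?e j)) \<notin> shading p) \<longleftrightarrow>
    (\<forall>j \<in> {1..n} - (J \<union> Q). (cnt J j, cnt (?e ` J) (?e j)) \<notin> shading p)"
    using Qp by blast
  with key show ?thesis by (simp add: Ball_def) blast
qed

lemma insert_order_isomorphic:
  assumes "distinct (xs @ ys)" "underlying p \<in> perms (length xs)" "underlying q \<in> perms (length ys)"
    "b \<le> length xs"
  shows "order_isomorphic (take a xs @ ys @ drop a xs) (underlying (insert_mesh p (a, b) q)) \<longleftrightarrow>
    order_isomorphic xs (underlying p) \<and> order_isomorphic ys (underlying q) \<and>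
    (\<forall>v \<in> set ys. cnt (set xs) v = b)"
proof -
  define k l where "k = length xs" and "l = length ys"
  define up where "up = (\<lambda>v. if v \<le> b then v else v + l)"
  define dn where "dn = (\<lambda>v. if v \<le> b then v else v - l)"
  let ?p = "underlying p" and ?q = "underlying q"
  let ?zs = "take a xs @ ys @ drop a xs"
  have P: "length ?p = k" "set ?p = {1..k}" and Q: "length ?q = l" "set ?q = {1..l}"
    using permsD(1,3)[OF assms(2)] permsD(1,3)[OF assms(3)] by (simp_all add: k_def l_def)
  have ins: "underlying (insert_mesh p (a, b) q) =
      take a (map up ?p) @ map (\<lambda>v. v + b) ?q @ drop a (map up ?p)"
    using Q by (simp add: insert_mesh_def Let_def up_def)
  have sx: "set (take a xs) \<union> set (drop a xs) = set xs"
    by (metis append_take_drop_id set_append)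
  have sz: "set ?zs = set xs \<union> set ys" using sx by auto
  have dx: "distinct xs" and dy: "distinct ys" and dis: "set xs \<inter> set ys = {}"
    using assms(1) by auto
  have dz: "distinct ?zs"
    using dx dy dis sx set_take_disj_set_drop_if_distinct[OF dx, of a a] by auto
  show ?thesis
  proof
    assume L: "order_isomorphic ?zs (underlying (insert_mesh p (a, b) q))"
    then obtain h where h: "strict_mono_on (set ?zs) h"
      and hm: "map h ?zs = underlying (insert_mesh p (a, b) q)"
      using order_isomorphic_iff[OF dz] by blast
    have h': "strict_mono_on (set xs \<union> set ys) h" using h unfolding sz .
    have m: "map h (take a xs) @ map h ys @ map h (drop a xs) =
        take a (map up ?p) @ map (\<lambda>v. v + b) ?q @ drop a (map up ?p)"
      using hm unfolding ins by simp
    have len: "length (map h (take a xs)) = length (take a (map up ?p))"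
      "length (map h ys) = length (map (\<lambda>v. v + b) ?q)"
      using P Q by (simp_all add: k_def l_def)
    then have m1: "map h (take a xs) = take a (map up ?p)" "map h ys = map (\<lambda>v. v + b) ?q"
      "map h (drop a xs) = drop a (map up ?p)"
      using m unfolding append_eq_append_conv[OF disjI1[OF len(1)]] append_eq_append_conv[OF disjI1[OF len(2)]]
      by blast+
    have hx: "map h xs = map up ?p"
      using m1(1,3) by (metis append_take_drop_id map_append)
    have x: "order_isomorphic xs ?p"
    proof -
      have "order_isomorphic (map h xs) ?p \<longleftrightarrow> order_isomorphic xs ?p"
        by (rule order_isomorphic_map[OF h']) auto
      moreover have "order_isomorphic (map up ?p) ?p \<longleftrightarrow> order_isomorphic ?p ?p"
        by (rule order_isomorphic_map[of UNIV]) (auto simp: strict_mono_on_def up_def)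
      ultimately show ?thesis unfolding hx by (simp add: order_isomorphic_def)
    qed
    have y: "order_isomorphic ys ?q"
    proof -
      have "order_isomorphic (map h ys) ?q \<longleftrightarrow> order_isomorphic ys ?q"
        by (rule order_isomorphic_map[OF h']) auto
      moreover have "order_isomorphic (map (\<lambda>v. v + b) ?q) ?q \<longleftrightarrow> order_isomorphic ?q ?q"
        by (rule order_isomorphic_map[of UNIV]) (auto simp: strict_mono_on_def)
      ultimately show ?thesis unfolding m1(2) by (simp add: order_isomorphic_def)
    qed
    have "cnt (set xs) v = b" if v: "v \<in> set ys" for v
    proof -
      have "h v \<in> (\<lambda>v. v + b) ` {1..l}"
        using v m1(2) Q by (metis image_eqI list.set_map)
      then obtain t where t: "t \<in> {1..l}" "h v = t + b" by blast
      have "h ` set xs = up ` {1..k}" using hx P by (metis list.set_map)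
      moreover have "{y \<in> up ` {1..k}. y < t + b} = {1..b}"
        using t(1) assms(4) by (auto simp: up_def k_def image_iff split: if_splits)
      ultimately have "cnt (h ` set xs) (h v) = b" using t(2) by (simp add: cnt_def)
      then show ?thesis using cnt_image[OF h', of "set xs" v] v by simp
    qed
    with x y show "order_isomorphic xs ?p \<and> order_isomorphic ys ?q \<and> (\<forall>v \<in> set ys. cnt (set xs) v = b)"
      by blast
  next
    assume R: "order_isomorphic xs ?p \<and> order_isomorphic ys ?q \<and> (\<forall>v \<in> set ys. cnt (set xs) v = b)"
    then obtain f g where f: "strict_mono_on (set xs) f" "map f xs = ?p"
      and g: "strict_mono_on (set ys) g" "map g ys = ?q"
      using order_isomorphic_iff[OF dx] order_isomorphic_iff[OF dy] by blast
    define h where "h = (\<lambda>v. if v \<in> set xs then up (f v) else g v + b)"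
    have fx: "f ` set xs = {1..k}" and gy: "g ` set ys = {1..l}"
      using f(2) g(2) P Q by (metis list.set_map)+
    have fc: "cnt (set xs) u = f u - 1" "f u \<ge> 1" if "u \<in> set xs" for u
    proof -
      have fu: "f u \<in> {1..k}" using fx that by blast
      then have "{y \<in> {1..k}. y < f u} = {1..<f u}" by auto
      then show "cnt (set xs) u = f u - 1"
        using cnt_image[OF f(1) _ that, of "set xs"] fx by (simp add: cnt_def)
      show "f u \<ge> 1" using fu by simp
    qed
    have hm: "map h ?zs = underlying (insert_mesh p (a, b) q)"
    proof -
      have 1: "map h (take a xs) = take a (map up ?p)" "map h (drop a xs) = drop a (map up ?p)"
        unfolding f(2)[symmetric] take_map drop_map map_map
        using sx by (auto simp: h_def)
      have 2: "map h ys = map (\<lambda>v. v + b) ?q"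
        unfolding g(2)[symmetric] map_map using dis by (auto simp: h_def)
      show ?thesis unfolding ins using 1 2 by simp
    qed
    have "h u < h v" if uv: "u \<in> set xs \<union> set ys" "v \<in> set xs \<union> set ys" "u < v" for u v
    proof -
      have mix: "h x < h y \<longleftrightarrow> x < y" if "x \<in> set xs" "y \<in> set ys" for x y
      proof -
        have c: "cnt (set xs) y = b" using R that by blast
        have gyl: "g y \<in> {1..l}" using gy that by blast
        have hh: "h x = up (f x)" "h y = g y + b" using that dis by (auto simp: h_def)
        have "x \<noteq> y" using that dis by auto
        then consider "x < y" | "y < x" by linarith
        then show ?thesis
        proof cases
          case 1
          have "cnt (set xs) x < cnt (set xs) y"
            unfolding cnt_def by (rule psubset_card_mono) (use 1 that in auto)
          then have "f x \<le> b" using fc[OF that(1)] c by simp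
          then show ?thesis using 1 hh gyl by (simp add: up_def)
        next
          case 2
          have "cnt (set xs) y \<le> cnt (set xs) x"
            unfolding cnt_def by (rule card_mono) (use 2 in auto)
          then have "f x > b" using fc[OF that(1)] c by simp
          then show ?thesis using 2 hh gyl by (simp add: up_def)
        qed
      qed
      have ne: "h x \<noteq> h y" if "x \<in> set xs" "y \<in> set ys" for x y
      proof -
        have gyl: "g y \<in> {1..l}" using gy that by blast
        have hh: "h x = up (f x)" "h y = g y + b" using that dis by (auto simp: h_def)
        show ?thesis using gyl unfolding hh by (auto simp: up_def)
      qed
      consider "u \<in> set xs" "v \<in> set xs" | "u \<in> set xs" "v \<in> set ys"
        | "u \<in> set ys" "v \<in> set xs" | "u \<in> set ys" "v \<in> set ys"
        using uv by blast
      then show ?thesis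
      proof cases
        case 1
        then have "f u < f v" using f(1) \<open>u < v\<close> by (simp add: strict_mono_on_less)
        then show ?thesis using 1 by (simp add: h_def up_def)
      next
        case 2
        then show ?thesis using mix \<open>u < v\<close> by blast
      next
        case 3
        then show ?thesis using mix[of v u] ne[of v u] \<open>u < v\<close> by linarith
      next
        case 4
        then have "g u < g v" using g(1) \<open>u < v\<close> by (simp add: strict_mono_on_less)
        moreover have "u \<notin> set xs" "v \<notin> set xs" using 4 dis by auto
        ultimately show ?thesis by (simp add: h_def)
      qed
    qed
    then have "strict_mono_on (set ?zs) h" unfolding sz strict_mono_on_def by blast
    with hm show "order_isomorphic ?zs (underlying (insert_mesh p (a, b) q))"
      using order_isomorphic_iff[OF dz] by blast
  qed
qed

lemma mesh_pattern_insert_mesh: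
  assumes "mesh_pattern p" "mesh_pattern q" "a \<le> length (underlying p)" "b \<le> length (underlying p)"
  shows "mesh_pattern (insert_mesh p (a, b) q)"
proof -
  define k l where "k = length (underlying p)" and "l = length (underlying q)"
  define up where "up = (\<lambda>v. if v \<le> b then v else v + l)"
  let ?T = "map up (underlying p)" and ?U = "map (\<lambda>v. v + b) (underlying q)"
  have pp: "underlying p \<in> perms k" and qq: "underlying q \<in> perms l"
    using assms(1,2) by (simp_all add: mesh_pattern_def Let_def k_def l_def)
  note P = permsD(1-3)[OF pp] and Q = permsD(1-3)[OF qq]
  have ins: "underlying (insert_mesh p (a, b) q) = take a ?T @ ?U @ drop a ?T"
    unfolding insert_mesh_def Let_def up_def l_def by simp
  have inj: "inj up" by (auto simp: inj_def up_def split: if_splits)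
  have dT: "distinct ?T" using P(2) inj_on_subset[OF inj] by (simp add: distinct_map)
  have dU: "distinct ?U" using Q(2) by (simp add: distinct_map)
  have sT: "set (take a ?T) \<union> set (drop a ?T) = set ?T"
    by (metis append_take_drop_id set_append)
  have T: "set ?T = {1..b} \<union> {b + l + 1..k + l}"
  proof -
    have "v \<in> up ` {1..k} \<longleftrightarrow> v \<in> {1..b} \<union> {b + l + 1..k + l}" for v
    proof
      assume "v \<in> up ` {1..k}" then show "v \<in> {1..b} \<union> {b + l + 1..k + l}"
        by (auto simp: up_def)
    next
      assume v: "v \<in> {1..b} \<union> {b + l + 1..k + l}"
      show "v \<in> up ` {1..k}"
      proof (cases "v \<le> b")
        case True
        then show ?thesis using v assms(4) by (intro image_eqI[of _ _ v]) (auto simp: up_def k_def)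
      next
        case False
        then show ?thesis using v by (intro image_eqI[of _ _ "v - l"]) (auto simp: up_def)
      qed
    qed
    then show ?thesis unfolding set_map P(3) by blast
  qed
  have U: "set ?U = {b + 1..b + l}"
    unfolding set_map Q(3) by (simp add: add.commute[of b])
  have "set (take a ?T @ ?U @ drop a ?T) = {1..k + l}"
  proof -
    have "set (take a ?T @ ?U @ drop a ?T) = (set (take a ?T) \<union> set (drop a ?T)) \<union> set ?U"
      unfolding set_append by blast
    also have "\<dots> = {1..k + l}"
      unfolding sT unfolding T U using assms(4) unfolding k_def[symmetric] by auto
    finally show ?thesis .
  qed
  moreover have "distinct (take a ?T @ ?U @ drop a ?T)"
  proof -
    have "set ?T \<inter> set ?U = {}" unfolding T U by auto
    then show ?thesis
      unfolding distinct_append set_append sT[symmetric]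
      using dT dU set_take_disj_set_drop_if_distinct[OF dT, of a a] distinct_take distinct_drop
      by blast
  qed
  moreover have "length (take a ?T @ ?U @ drop a ?T) = k + l"
    by (simp add: k_def l_def)
  moreover have "shading (insert_mesh p (a, b) q) \<subseteq> {0..k + l} \<times> {0..k + l}"
    by (auto simp: insert_mesh_def Let_def k_def l_def)
  ultimately show ?thesis
    unfolding mesh_pattern_def ins Let_def perms_def permutations_of_set_def by simp
qed

lemma sorted_gap:
  assumes "sorted_wrt (<) js" "a \<le> length js"
  shows "(\<forall>y \<in> set (take a js). y < x) \<and> (\<forall>y \<in> set (drop a js). x < y) \<longleftrightarrow>
    x \<notin> set js \<and> cnt (set js) x = a"
proof -
  have d: "distinct js" using assms(1) strict_sorted_iff by blast
  have st: "set js = set (take a js) \<union> set (drop a js)"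
    by (metis append_take_drop_id set_append)
  have lt: "y < z" if "y \<in> set (take a js)" "z \<in> set (drop a js)" for y z
    using assms(1) that by (metis append_take_drop_id sorted_wrt_append)
  have c: "card (set (take a js)) = a"
    using d assms(2) by (simp add: distinct_card)
  show ?thesis
  proof
    assume L: "(\<forall>y \<in> set (take a js). y < x) \<and> (\<forall>y \<in> set (drop a js). x < y)"
    then have "{y \<in> set js. y < x} = set (take a js)" "x \<notin> set js"
      unfolding st by force+
    then show "x \<notin> set js \<and> cnt (set js) x = a" using c by (simp add: cnt_def)
  next
    assume R: "x \<notin> set js \<and> cnt (set js) x = a"
    have "y < x" if y: "y \<in> set (take a js)" for y
    proof (rule ccontr)
      assume "\<not> y < x"
      then have "{z \<in> set js. z < x} \<subseteq> set (take a js) - {y}"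
        using lt[OF y] st by force
      then have "cnt (set js) x \<le> card (set (take a js) - {y})"
        unfolding cnt_def by (rule card_mono[rotated]) simp
      also have "\<dots> < a" using y c by (metis card_Diff1_less finite_set)
      finally show False using R by simp
    qed
    moreover have "x < y" if y: "y \<in> set (drop a js)" for y
    proof (rule ccontr)
      assume "\<not> x < y"
      moreover have "x \<noteq> y" using R y st by blast
      ultimately have "y < x" by simp
      then have "insert y (set (take a js)) \<subseteq> {z \<in> set js. z < x}"
        using lt[OF _ y] st y by force
      then have "card (insert y (set (take a js))) \<le> cnt (set js) x"
        unfolding cnt_def by (rule card_mono[rotated]) simp
      moreover have "y \<notin> set (take a js)" using lt[OF _ y] by blast
      ultimately show False using R c by simp
    qed
    ultimately show "(\<forall>y \<in> set (take a js). y < x) \<and> (\<forall>y \<in> set (drop a js). x < y)" by blast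
  qed
qed

lemma occurrence_insert_mesh_aux:
  assumes "\<pi> \<in> perms n" "mesh_pattern p" "mesh_pattern q"
    and "a \<le> length (underlying p)" "b \<le> length (underlying p)" "(a, b) \<notin> shading p"
    and "length js = length (underlying p)" "length qs = length (underlying q)"
  shows "occurrence (insert_mesh p (a, b) q) \<pi> (take a js @ qs @ drop a js) \<longleftrightarrow>
    occurrence p \<pi> js \<and> sorted_wrt (<) qs \<and> set qs \<subseteq> set (box_positions \<pi> js a b) \<and>
    order_isomorphic (map (entry \<pi>) qs) (underlying q) \<and>
    (\<forall>j \<in> set (box_positions \<pi> js a b) - set qs.
      (cnt (set qs) j, cnt (entry \<pi> ` set qs) (entry \<pi> j)) \<notin> shading q)"
    (is "?L \<longleftrightarrow> ?R")
proof -
  let ?is = "take a js @ qs @ drop a js" and ?e = "entry \<pi>" and ?P = "insert_mesh p (a, b) q"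
  note al = assms(4,5)[folded assms(7)]
  have pp: "underlying p \<in> perms (length js)" and qq: "underlying q \<in> perms (length qs)"
    using assms(2,3,7,8) by (simp_all add: mesh_pattern_def Let_def)
  note P = mesh_pattern_insert_mesh[OF assms(2-5)]
  have st: "set js = set (take a js) \<union> set (drop a js)"
    by (metis append_take_drop_id set_append)
  then have si: "set ?is = set js \<union> set qs" by auto
  have so: "sorted_wrt (<) ?is \<longleftrightarrow> sorted_wrt (<) js \<and> sorted_wrt (<) qs \<and>
      (\<forall>x \<in> set qs. x \<notin> set js \<and> cnt (set js) x = a)"
  proof -
    have "sorted_wrt (<) ?is \<longleftrightarrow> sorted_wrt (<) (take a js @ drop a js) \<and> sorted_wrt (<) qs \<and>
        (\<forall>x \<in> set qs. (\<forall>y \<in> set (take a js). y < x) \<and> (\<forall>y \<in> set (drop a js). x < y))"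
      unfolding sorted_wrt_append by auto
    then show ?thesis using sorted_gap[OF _ al(1)] by auto
  qed
  have main: "?L \<longleftrightarrow> ?R" if js: "sorted_wrt (<) js" "set js \<subseteq> {1..n}" and qs: "sorted_wrt (<) qs"
    "set qs \<subseteq> {1..n}" "\<forall>x \<in> set qs. x \<notin> set js \<and> cnt (set js) x = a"
  proof -
    note B = set_box_positions[OF assms(1) js al]
    have dj: "distinct js" and dq: "distinct qs" using js(1) qs(1) strict_sorted_iff by blast+
    have "set js \<inter> set qs = {}" using qs(3) by blast
    have "distinct (js @ qs)" "set (js @ qs) \<subseteq> {1..n}" using dj dq qs js(2) by auto
    then have d: "distinct (map ?e js @ map ?e qs)"
      using permsD(4)[OF assms(1)] unfolding map_append[symmetric] distinct_map
      by (blast intro: inj_on_subset)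
    have oi: "order_isomorphic (map ?e ?is) (underlying ?P) \<longleftrightarrow>
      order_isomorphic (map ?e js) (underlying p) \<and> order_isomorphic (map ?e qs) (underlying q) \<and>
      (\<forall>x \<in> set qs. cnt (?e ` set js) (?e x) = b)"
      using insert_order_isomorphic[OF d, of p q b a] pp qq al(2)
      by (simp add: take_map drop_map)
    have sub: "set qs \<subseteq> set (box_positions \<pi> js a b) \<longleftrightarrow> (\<forall>x \<in> set qs. cnt (?e ` set js) (?e x) = b)"
      unfolding B using qs by auto
    have card: "card (set js) = length (underlying p)" "card (set qs) = length (underlying q)"
      using dj dq assms(7,8) by (simp_all add: distinct_card)
    have sh: "(\<forall>j \<in> {1..n} - (set js \<union> set qs). (cnt (set js \<union> set qs) j,
          cnt (?e ` (set js \<union> set qs)) (?e j)) \<notin> shading ?P) \<longleftrightarrow>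
        (\<forall>j \<in> {1..n} - set js. (cnt (set js) j, cnt (?e ` set js) (?e j)) \<notin> shading p) \<and>
        (\<forall>j \<in> set (box_positions \<pi> js a b) - set qs. (cnt (set qs) j, cnt (?e ` set qs) (?e j)) \<notin> shading q)"
      if "\<forall>x \<in> set qs. cnt (?e ` set js) (?e x) = b"
      unfolding B
      by (rule insert_mesh_shading[OF assms(1) js(2) qs(2) \<open>set js \<inter> set qs = {}\<close> _ _ card assms(6)])
        (use qs(3) that in auto)
    have sI: "sorted_wrt (<) ?is" "set js \<union> set qs \<subseteq> {1..n}" using so js qs by auto
    show ?thesis
      unfolding occurrence_iff[OF assms(1) P] occurrence_iff[OF assms(1,2)] si oi sub
      using sh js(1,2) qs(1) sI by argo
  qed
  show ?thesis
  proof
    assume L: ?L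
    then have "sorted_wrt (<) ?is" "set ?is \<subseteq> {1..n}"
      unfolding occurrence_iff[OF assms(1) P] by blast+
    then have "sorted_wrt (<) js" "set js \<subseteq> {1..n}" "sorted_wrt (<) qs" "set qs \<subseteq> {1..n}"
      "\<forall>x \<in> set qs. x \<notin> set js \<and> cnt (set js) x = a"
      unfolding so si by blast+
    with main L show ?R by blast
  next
    assume R: ?R
    then have js: "sorted_wrt (<) js" "set js \<subseteq> {1..n}"
      unfolding occurrence_iff[OF assms(1,2)] by blast+
    have "set qs \<subseteq> {1..n}" "\<forall>x \<in> set qs. x \<notin> set js \<and> cnt (set js) x = a"
      using R unfolding set_box_positions[OF assms(1) js al] by blast+
    with main js R show ?L by blast
  qed
qed

text \<open>
  An occurrence of the inserted pattern consists of an occurrence of the base pattern and an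
  occurrence of \<open>q\<close> in the permutation order-isomorphic to the elements in the box.
\<close>

theorem occurrence_insert_mesh:
  assumes "\<pi> \<in> perms n" "mesh_pattern p" "mesh_pattern q"
    and "a \<le> length (underlying p)" "b \<le> length (underlying p)" "(a, b) \<notin> shading p"
  shows "occurrence (insert_mesh p (a, b) q) \<pi> js \<longleftrightarrow>
    (\<exists>ms ks. occurrence p \<pi> ms \<and> occurrence q (standardize (box_elements \<pi> ms a b)) ks \<and>
      js = take a ms @ map (\<lambda>i. box_positions \<pi> ms a b ! (i - 1)) ks @ drop a ms)"
    (is "?L \<longleftrightarrow> ?R")
proof -
  let ?k = "length (underlying p)" and ?l = "length (underlying q)" and ?e = "entry \<pi>"
  note aux = occurrence_insert_mesh_aux[OF assms]
  have lenP: "length (underlying (insert_mesh p (a, b) q)) = ?k + ?l"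
    by (simp add: insert_mesh_def Let_def)
  have len: "length us = length (underlying r)" if "occurrence r \<rho> us" for r \<rho> us
    using that by (simp add: occurrence_def order_isomorphic_def)
  have Bs: "sorted_wrt (<) (box_positions \<pi> ms a b)" for ms
    unfolding box_positions_def Let_def by (intro sorted_wrt_filter sorted_wrt_upt)
  have Bn: "set (box_positions \<pi> ms a b) \<subseteq> {1..n}" for ms
    using permsD(1)[OF assms(1)] by (auto simp: box_positions_def Let_def simp del: upt_Suc)
  show ?thesis
  proof
    assume L: ?L
    define ms where "ms = take a js @ drop (a + ?l) js"
    define qs where "qs = take ?l (drop a js)"
    have lj: "length js = ?k + ?l" using len[OF L] lenP by simp
    have ll: "length ms = ?k" "length qs = ?l" using lj assms(4) by (simp_all add: ms_def qs_def)
    have "js = take a js @ qs @ drop (a + ?l) js"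
      unfolding qs_def by (metis add.commute append_take_drop_id drop_drop)
    moreover have "take a ms = take a js" "drop a ms = drop (a + ?l) js"
      using lj assms(4) by (simp_all add: ms_def)
    ultimately have js: "js = take a ms @ qs @ drop a ms" by simp
    let ?B = "box_positions \<pi> ms a b"
    note R = L[unfolded js aux[OF ll]]
    define ks where "ks = map (\<lambda>x. SOME i. i \<in> {1..length ?B} \<and> ?B ! (i - 1) = x) qs"
    have ex: "\<exists>i. i \<in> {1..length ?B} \<and> ?B ! (i - 1) = x" if "x \<in> set qs" for x
    proof -
      have "x \<in> set ?B" using R that by blast
      then obtain i where "i < length ?B" "?B ! i = x" by (meson in_set_conv_nth)
      then show ?thesis by (intro exI[of _ "Suc i"]) auto
    qed
    have ch: "(SOME i. i \<in> {1..length ?B} \<and> ?B ! (i - 1) = x) \<in> {1..length ?B} \<and>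
        ?B ! ((SOME i. i \<in> {1..length ?B} \<and> ?B ! (i - 1) = x) - 1) = x" if "x \<in> set qs" for x
      by (rule someI_ex[OF ex[OF that]])
    have kB: "set ks \<subseteq> {1..length ?B}" unfolding ks_def set_map using ch by blast
    have kq: "map (\<lambda>i. ?B ! (i - 1)) ks = qs"
      unfolding ks_def map_map by (rule map_idI) (use ch in simp)
    have kq': "(\<lambda>i. ?B ! (i - 1)) ` set ks = set qs" using kq by (metis list.set_map)
    have "occurrence q (standardize (box_elements \<pi> ms a b)) ks"
      unfolding box_elements_def occurrence_standardize[OF assms(1,3) Bs Bn kB] kq kq'
      using R by blast
    then show ?R using R js kq by metis
  next
    assume ?R
    then obtain ms ks where ms: "occurrence p \<pi> ms"
      and ks: "occurrence q (standardize (box_elements \<pi> ms a b)) ks"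
      and js: "js = take a ms @ map (\<lambda>i. box_positions \<pi> ms a b ! (i - 1)) ks @ drop a ms" by blast
    let ?B = "box_positions \<pi> ms a b"
    have kB: "set ks \<subseteq> {1..length ?B}"
      using ks by (simp add: occurrence_def standardize_def box_elements_def)
    define qs where "qs = map (\<lambda>i. ?B ! (i - 1)) ks"
    have kq: "(\<lambda>i. ?B ! (i - 1)) ` set ks = set qs" by (simp add: qs_def)
    have sq: "set qs \<subseteq> set ?B"
    proof
      fix x assume "x \<in> set qs"
      then obtain i where i: "i \<in> set ks" "x = ?B ! (i - 1)" unfolding qs_def by auto
      then have "i - 1 < length ?B" using kB by force
      then show "x \<in> set ?B" using i by simp
    qed
    have ll: "length ms = ?k" "length qs = ?l" using len[OF ms] len[OF ks] by (simp_all add: qs_def)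
    show ?L
      unfolding js qs_def[symmetric] aux[OF ll]
      using ms sq ks[unfolded box_elements_def occurrence_standardize[OF assms(1,3) Bs Bn kB] kq, folded qs_def]
      by blast
  qed
qed

end

theory Submission
  imports Defs
begin

text \<open>
  Write \<open>\<sigma> \<oplus> \<tau>\<close> for the direct sum, in which \<open>\<tau>\<close> is placed above and to the right of \<open>\<sigma>\<close>. The
  shading of the base pattern forces everything outside its two letters into the boxes \<open>(0, 0)\<close> and
  \<open>(2, 2)\<close>. So an occurrence of the base pattern in \<open>\<pi>\<close> is a way of writing \<open>\<pi> = \<sigma> \<oplus> 12 \<oplus> \<tau>\<close>,
  and \<open>\<pi>\<close> contains \<open>p\<close> iff some such \<open>\<tau>\<close> contains \<open>p1\<close> (\<open>contains_insert_base_iff\<close>).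

  It is enough to look at the first occurrence. A later one yields \<open>\<tau>'\<close> with \<open>\<tau> = \<rho> \<oplus> \<tau>'\<close>, and an
  occurrence of \<open>p1\<close> in \<open>\<tau>'\<close> is also one in \<open>\<rho> \<oplus> \<tau>'\<close>, as all of \<open>\<rho>\<close> lies in the box
  \<open>(0, 0)\<close>, which is not shaded (\<open>contains_dsum\<close>). Hence \<open>\<pi>\<close> avoids \<open>p\<close> iff it has no occurrence of
  the base pattern or the \<open>\<tau>\<close> of the first one avoids \<open>p1\<close> (\<open>avoiders_decomposition\<close>).

  Let \<open>B\<close> count the permutations without an occurrence of the base pattern, and let \<open>C\<close> count the
  permutations \<open>\<sigma>\<close> that can stand before the first one. These are the \<open>\<sigma>\<close> for which \<open>\<sigma> \<oplus> 1\<close> has no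
  occurrence, so a permutation counted by \<open>B\<close> is either counted by \<open>C\<close>, or of the form \<open>\<sigma> \<oplus> 1\<close> with
  \<open>\<sigma>\<close> counted by \<open>C\<close>. With \<open>A\<close> and \<open>A1\<close> for the avoiders of \<open>p\<close> and \<open>p1\<close>, we get
  \<open>B = (1 + x) C\<close>, \<open>F = B + x\<^sup>2 C F\<close> and \<open>A = B + x\<^sup>2 C A1\<close>. The first two equations give
  \<open>C = F / (1 + x + x\<^sup>2 F)\<close>, and the third is then the theorem.
\<close>

section \<open>Direct sums and cuts\<close>

lemma perms_iff: "\<pi> \<in> perms n \<longleftrightarrow> distinct \<pi> \<and> set \<pi> = {1..n}"
  by (auto simp: perms_def permutations_of_set_def)

lemma finite_perms [simp]: "finite (perms n)"
  by (simp add: perms_def)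

lemma card_perms: "card (perms n) = fact n"
  by (simp add: perms_def)

lemma perms_0: "perms 0 = {[]}"
  by (simp add: perms_def)

lemma perms_1: "perms 1 = {[1]}"
  by (simp add: perms_def)

lemma perms_2: "[1, 2] \<in> perms 2"
  by (simp add: perms_iff numeral_2_eq_2 atLeastAtMostSuc_conv insert_commute)

lemma image_add_interval: "(\<lambda>v. v + k) ` {1..m} = {k + 1..k + m :: nat}"
  by (simp add: add.commute image_add_atLeastAtMost')

definition dsum :: "nat list \<Rightarrow> nat list \<Rightarrow> nat list" where
  "dsum \<sigma> \<tau> = \<sigma> @ map (\<lambda>v. v + length \<sigma>) \<tau>"

lemma length_dsum [simp]: "length (dsum \<sigma> \<tau>) = length \<sigma> + length \<tau>"
  by (simp add: dsum_def)

lemma dsum_perms: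
  assumes "\<sigma> \<in> perms k" "\<tau> \<in> perms m"
  shows "dsum \<sigma> \<tau> \<in> perms (k + m)"
proof -
  have "length \<sigma> = k" "distinct \<sigma>" "set \<sigma> = {1..k}" "distinct \<tau>" "set \<tau> = {1..m}"
    using permsD[OF assms(1)] permsD[OF assms(2)] by blast+
  moreover have "{1..k} \<union> {k + 1..k + m} = {1..k + m}" by auto
  ultimately show ?thesis
    unfolding perms_iff dsum_def set_append set_map distinct_append
    by (simp add: distinct_map image_add_interval del: image_add_atLeastAtMost' One_nat_def)
qed

lemma dsum_1_perms: "\<sigma> \<in> perms k \<Longrightarrow> dsum \<sigma> [1] \<in> perms (k + 1)"
  using dsum_perms[of \<sigma> k "[1]" 1] perms_1 by blast

lemma dsum_Nil [simp]: "dsum [] \<tau> = \<tau>"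
  by (simp add: dsum_def)

lemma dsum_assoc: "dsum (dsum \<rho> \<sigma>) \<tau> = dsum \<rho> (dsum \<sigma> \<tau>)"
  by (simp add: dsum_def add_ac)

lemma dsum_inject:
  "length \<sigma> = length \<sigma>' \<Longrightarrow> dsum \<sigma> \<tau> = dsum \<sigma>' \<tau>' \<longleftrightarrow> \<sigma> = \<sigma>' \<and> \<tau> = \<tau>'"
  by (auto simp: dsum_def inj_def intro: map_injective)

lemma entry_dsum_left: "1 \<le> j \<Longrightarrow> j \<le> length \<sigma> \<Longrightarrow> entry (dsum \<sigma> \<tau>) j = entry \<sigma> j"
  by (auto simp: entry_def dsum_def nth_append)

lemma entry_dsum_right:
  assumes "length \<sigma> < j" "j \<le> length \<sigma> + length \<tau>"
  shows "entry (dsum \<sigma> \<tau>) j = entry \<tau> (j - length \<sigma>) + length \<sigma>"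
proof -
  have "\<not> j - 1 < length \<sigma>" "j - 1 - length \<sigma> = j - length \<sigma> - 1" "j - length \<sigma> - 1 < length \<tau>"
    using assms by linarith+
  then show ?thesis by (simp only: entry_def dsum_def nth_append nth_map if_False)
qed

text \<open>
  A cut at \<open>k\<close> is a decomposition \<open>\<pi> = \<sigma> \<oplus> \<tau>\<close> with \<open>\<sigma>\<close> of length \<open>k\<close>
  (\<open>cut_iff_dsum\<close>). The form chosen here depends only on the first \<open>k\<close> letters, so that cuts are
  easily compared between a list and its prefixes.
\<close>

definition cut :: "nat \<Rightarrow> nat list \<Rightarrow> bool" where
  "cut k \<pi> \<longleftrightarrow> k \<le> length \<pi> \<and> set (take k \<pi>) = {1..k}"

lemma cut_iff_dsum:
  assumes "\<pi> \<in> perms n"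
  shows "cut k \<pi> \<longleftrightarrow> k \<le> n \<and> (\<exists>\<sigma> \<in> perms k. \<exists>\<tau> \<in> perms (n - k). \<pi> = dsum \<sigma> \<tau>)"
proof
  assume c: "cut k \<pi>"
  note P = permsD(1-3)[OF assms]
  have k: "k \<le> n" and s: "set (take k \<pi>) = {1..k}"
    using c P by (auto simp: cut_def)
  have dis: "set (take k \<pi>) \<inter> set (drop k \<pi>) = {}"
    using P(2) by (simp add: set_take_disj_set_drop_if_distinct)
  have "set (take k \<pi>) \<union> set (drop k \<pi>) = {1..n}"
    using P(3) by (metis append_take_drop_id set_append)
  with dis s have "set (drop k \<pi>) = {1..n} - {1..k}" by blast
  moreover have "{1..n} - {1..k} = {k + 1..n}" by auto
  ultimately have d: "set (drop k \<pi>) = {k + 1..n}" by simp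
  define \<tau> where "\<tau> = map (\<lambda>v. v - k) (drop k \<pi>)"
  have "inj_on (\<lambda>v. v - k) {k + 1..n}" by (auto simp: inj_on_def)
  moreover have "(\<lambda>v. v - k) ` {k + 1..n} = {1..n - k}"
  proof -
    have "{k + 1..n} = (\<lambda>v. v + k) ` {1..n - k}" unfolding image_add_interval using k by simp
    then have "(\<lambda>v. v - k) ` {k + 1..n} = (\<lambda>v. v + k - k) ` {1..n - k}"
      by (simp only: image_image)
    then show ?thesis by simp
  qed
  ultimately have "\<tau> \<in> perms (n - k)"
    using P(2) d by (simp add: perms_iff \<tau>_def distinct_map del: One_nat_def)
  moreover have "take k \<pi> \<in> perms k" using P(2) s by (simp add: perms_iff)
  moreover have "\<pi> = dsum (take k \<pi>) \<tau>"
  proof -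
    have "map (\<lambda>v. v + k) \<tau> = drop k \<pi>"
      unfolding \<tau>_def map_map by (rule map_idI) (use d in auto)
    then show ?thesis using k P(1) by (simp add: dsum_def)
  qed
  ultimately show "k \<le> n \<and> (\<exists>\<sigma> \<in> perms k. \<exists>\<tau> \<in> perms (n - k). \<pi> = dsum \<sigma> \<tau>)" using k by blast
next
  assume "k \<le> n \<and> (\<exists>\<sigma> \<in> perms k. \<exists>\<tau> \<in> perms (n - k). \<pi> = dsum \<sigma> \<tau>)"
  then obtain \<sigma> \<tau> where "\<sigma> \<in> perms k" "\<pi> = dsum \<sigma> \<tau>" by blast
  then show "cut k \<pi>" using permsD[of \<sigma> k] by (simp add: cut_def dsum_def)
qed

text \<open>
  The values at the first \<open>k\<close> positions are closed downwards, and the only downward closed set of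
  \<open>k\<close> values is \<open>{1..k}\<close>.
\<close>

lemma cutI:
  assumes "\<pi> \<in> perms n" "k \<le> n"
    and less: "\<And>x y. x \<in> {1..k} \<Longrightarrow> y \<in> {k + 1..n} \<Longrightarrow> entry \<pi> x < entry \<pi> y"
  shows "cut k \<pi>"
proof -
  note P = permsD[OF assms(1)]
  let ?S = "entry \<pi> ` {1..k}"
  have S: "set (take k \<pi>) = ?S"
  proof -
    have "take k \<pi> = take k (map (entry \<pi>) [1..<n + 1])" using P(6) by simp
    also have "\<dots> = map (entry \<pi>) [1..<k + 1]" using assms(2) by (simp add: take_map del: upt_Suc)
    finally show ?thesis by (simp add: atLeastLessThanSuc_atLeastAtMost del: upt_Suc)
  qed
  have sub: "{1..k} \<subseteq> {1..n}" using assms(2) by auto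
  have card: "card ?S = k"
    using inj_on_subset[OF P(4) sub] by (simp add: card_image)
  have down: "u \<in> ?S" if v: "v \<in> ?S" and u: "u \<in> {1..n}" "u < v" for u v
  proof -
    obtain x where x: "x \<in> {1..k}" "v = entry \<pi> x" using v by blast
    have "u \<in> entry \<pi> ` {1..n}" unfolding P(5) by (rule u(1))
    then obtain y where y: "y \<in> {1..n}" "u = entry \<pi> y" by blast
    then have "y \<in> {1..k}" using less[OF x(1), of y] u(2) x(2) by force
    then show ?thesis using y by blast
  qed
  have "?S \<subseteq> {1..k}"
  proof
    fix v assume v: "v \<in> ?S"
    then have "v \<in> {1..n}" using P(5) sub by blast
    have "{1..v} \<subseteq> ?S"
    proof
      fix u assume "u \<in> {1..v}"
      then show "u \<in> ?S" using v down[OF v, of u] \<open>v \<in> {1..n}\<close> by (cases "u = v") auto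
    qed
    then have "card {1..v} \<le> card ?S" by (rule card_mono[rotated]) simp
    then show "v \<in> {1..k}" using card \<open>v \<in> {1..n}\<close> by simp
  qed
  then have "?S = {1..k}" 
    by (rule card_subset_eq[rotated])
      (simp_all only: card card_atLeastAtMost finite_atLeastAtMost diff_Suc_1 Suc_eq_plus1[symmetric])
  then show ?thesis using S P(1) assms(2) by (simp add: cut_def)
qed

lemma cut_entry:
  assumes "\<pi> \<in> perms n" "cut k \<pi>" "x \<in> {1..n}"
  shows "entry \<pi> x \<le> k \<longleftrightarrow> x \<le> k"
proof -
  obtain \<sigma> \<tau> where k: "k \<le> n" and \<sigma>: "\<sigma> \<in> perms k" and \<tau>: "\<tau> \<in> perms (n - k)" and \<pi>: "\<pi> = dsum \<sigma> \<tau>"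
    using assms(2) cut_iff_dsum[OF assms(1)] by blast
  note S = permsD[OF \<sigma>] and T = permsD[OF \<tau>]
  show ?thesis
  proof (cases "x \<le> k")
    case True
    then have "entry \<pi> x = entry \<sigma> x" using assms(3) S(1) by (simp add: \<pi> entry_dsum_left)
    moreover have "x \<in> {1..k}" using True assms(3) by simp
    then have "entry \<sigma> x \<in> {1..k}" using S(5) by blast
    ultimately show ?thesis using True by simp
  next
    case False
    then have "entry \<pi> x = entry \<tau> (x - k) + k" using assms(3) S(1) T(1) k
      by (simp add: \<pi> entry_dsum_right)
    moreover have "x - k \<in> {1..n - k}" using False assms(3) by auto
    then have "entry \<tau> (x - k) \<in> {1..n - k}" using T(5) by blast
    ultimately show ?thesis using False by simp
  qed
qed

lemma cut_dsum: "\<sigma> \<in> perms k \<Longrightarrow> cut k (dsum \<sigma> \<tau>)"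
  using permsD[of \<sigma> k] by (simp add: cut_def dsum_def)

lemma cut_before_last:
  assumes "\<pi> \<in> perms (k + 1)" "cut k \<pi>"
  obtains \<sigma> where "\<sigma> \<in> perms k" "\<pi> = dsum \<sigma> [1]"
proof -
  obtain \<sigma> \<tau> where \<sigma>: "\<sigma> \<in> perms k" and \<tau>: "\<tau> \<in> perms (k + 1 - k)" and \<pi>: "\<pi> = dsum \<sigma> \<tau>"
    using assms(2) unfolding cut_iff_dsum[OF assms(1)] by blast
  have "\<tau> = [1]" using \<tau> unfolding diff_add_inverse perms_1 by (rule singletonD)
  with \<sigma> \<pi> that show ?thesis by blast
qed

lemma cut_dsum_left: "k \<le> length \<sigma> \<Longrightarrow> cut k (dsum \<sigma> \<tau>) \<longleftrightarrow> cut k \<sigma>"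
  by (simp add: cut_def dsum_def)

lemma cut_dsum_right:
  assumes "\<sigma> \<in> perms k" "0 \<notin> set \<tau>"
  shows "cut (k + i) (dsum \<sigma> \<tau>) \<longleftrightarrow> cut i \<tau>"
proof -
  note P = permsD[OF assms(1)]
  have "{1..k} \<union> (\<lambda>v. v + k) ` T = {1..k + i} \<longleftrightarrow> T = {1..i}" if "0 \<notin> T" for T
  proof
    assume L: "{1..k} \<union> (\<lambda>v. v + k) ` T = {1..k + i}"
    have "(\<lambda>v. v + k) ` T = (\<lambda>v. v + k) ` {1..i}"
    proof -
      have "{1..k} \<inter> (\<lambda>v. v + k) ` T = {}" using that by (auto intro: gr0I)
      then have "(\<lambda>v. v + k) ` T = {1..k + i} - {1..k}" unfolding L[symmetric] by blast
      also have "\<dots> = {k + 1..k + i}" by auto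
      finally show ?thesis unfolding image_add_interval .
    qed
    then show "T = {1..i}" by (subst (asm) inj_image_eq_iff) (simp_all add: inj_def)
  next
    assume "T = {1..i}"
    then show "{1..k} \<union> (\<lambda>v. v + k) ` T = {1..k + i}" unfolding image_add_interval by auto
  qed
  moreover have "0 \<notin> set (take i \<tau>)" using assms(2) by (meson in_set_takeD)
  ultimately show ?thesis
    using P(1,3) by (simp add: cut_def dsum_def take_map del: One_nat_def)
qed

section \<open>Double cuts\<close>

text \<open>
  Cuts at \<open>k\<close> and \<open>k + 1\<close> enclose a summand \<open>1\<close>, so three consecutive cuts enclose \<open>12\<close>
  (\<open>double_cut_iff_dsum_12\<close>).
\<close>

definition double_cut :: "nat \<Rightarrow> nat list \<Rightarrow> bool" where
  "double_cut k \<pi> \<longleftrightarrow> cut k \<pi> \<and> cut (k + 1) \<pi> \<and> cut (k + 2) \<pi>"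

lemma double_cut_length: "double_cut k \<pi> \<Longrightarrow> k + 2 \<le> length \<pi>"
  by (simp add: double_cut_def cut_def)

lemma double_cut_dsum_left:
  "k + 2 \<le> length \<sigma> \<Longrightarrow> double_cut k (dsum \<sigma> \<tau>) \<longleftrightarrow> double_cut k \<sigma>"
  by (simp add: double_cut_def cut_dsum_left)

definition dsum_12 :: "nat list \<Rightarrow> nat list \<Rightarrow> nat list" where
  "dsum_12 \<sigma> \<tau> = dsum (dsum \<sigma> [1, 2]) \<tau>"

lemma dsum_12_eq_dsum_1_1: "dsum_12 \<sigma> \<tau> = dsum (dsum \<sigma> [1]) (dsum [1] \<tau>)"
  by (simp add: dsum_12_def dsum_def)

lemma dsum_12_perms:
  assumes "\<sigma> \<in> perms k" "\<tau> \<in> perms m"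
  shows "dsum_12 \<sigma> \<tau> \<in> perms (k + 2 + m)"
  unfolding dsum_12_def using assms perms_2 by (intro dsum_perms)

lemma drop_dsum_12: "drop (length \<sigma> + 2) (dsum_12 \<sigma> \<tau>) = map (\<lambda>v. v + (length \<sigma> + 2)) \<tau>"
  by (simp add: dsum_12_def dsum_def)

lemma double_cut_iff_dsum_12:
  assumes "\<pi> \<in> perms n"
  shows "double_cut k \<pi> \<longleftrightarrow>
    k + 2 \<le> n \<and> (\<exists>\<sigma> \<in> perms k. \<exists>\<tau> \<in> perms (n - k - 2). \<pi> = dsum_12 \<sigma> \<tau>)"
proof
  assume d: "double_cut k \<pi>"
  then have "cut (k + 2) \<pi>" by (simp add: double_cut_def)
  then obtain \<alpha> \<tau> where n: "k + 2 \<le> n" and \<alpha>: "\<alpha> \<in> perms (k + 2)"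
    and \<tau>: "\<tau> \<in> perms (n - (k + 2))" and \<pi>: "\<pi> = dsum \<alpha> \<tau>"
    unfolding cut_iff_dsum[OF assms] by blast
  have \<alpha>': "\<alpha> \<in> perms (k + 1 + 1)" using \<alpha> by (simp add: numeral_2_eq_2)
  have "cut (k + 1) \<alpha>"
    using d permsD(1)[OF \<alpha>] by (simp add: double_cut_def \<pi> cut_dsum_left del: One_nat_def)
  then obtain \<beta> where \<beta>: "\<beta> \<in> perms (k + 1)" "\<alpha> = dsum \<beta> [1]"
    by (rule cut_before_last[OF \<alpha>'])
  have "cut k \<beta>"
    using d permsD(1)[OF \<beta>(1)] permsD(1)[OF \<alpha>]
    by (simp add: double_cut_def \<pi> \<beta>(2) cut_dsum_left)
  then obtain \<sigma> where \<sigma>: "\<sigma> \<in> perms k" "\<beta> = dsum \<sigma> [1]"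
    by (rule cut_before_last[OF \<beta>(1)])
  have "\<pi> = dsum_12 \<sigma> \<tau>"
    by (simp add: \<pi> \<beta>(2) \<sigma>(2) dsum_12_def dsum_def)
  then show "k + 2 \<le> n \<and> (\<exists>\<sigma> \<in> perms k. \<exists>\<tau> \<in> perms (n - k - 2). \<pi> = dsum_12 \<sigma> \<tau>)"
    using n \<tau>[folded diff_diff_left] \<sigma>(1) by blast
next
  assume "k + 2 \<le> n \<and> (\<exists>\<sigma> \<in> perms k. \<exists>\<tau> \<in> perms (n - k - 2). \<pi> = dsum_12 \<sigma> \<tau>)"
  then obtain \<sigma> \<tau> where \<sigma>: "\<sigma> \<in> perms k" and \<pi>: "\<pi> = dsum_12 \<sigma> \<tau>" by blast
  have "cut k \<pi>"
    unfolding \<pi> dsum_12_def dsum_assoc by (rule cut_dsum[OF \<sigma>])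
  moreover have "cut (k + 1) \<pi>"
    unfolding \<pi> dsum_12_eq_dsum_1_1 by (rule cut_dsum[OF dsum_1_perms[OF \<sigma>]])
  moreover have "cut (k + 2) \<pi>"
    unfolding \<pi> dsum_12_def by (rule cut_dsum[OF dsum_perms[OF \<sigma> perms_2]])
  ultimately show "double_cut k \<pi>" by (simp add: double_cut_def)
qed

lemma double_cut_entries:
  assumes "\<pi> \<in> perms n" "double_cut k \<pi>"
  shows "k + 2 \<le> n" "entry \<pi> (k + 1) = k + 1" "entry \<pi> (k + 2) = k + 2"
    and "x \<in> {1..n} \<Longrightarrow> entry \<pi> x \<le> k \<longleftrightarrow> x \<le> k"
    and "x \<in> {1..n} \<Longrightarrow> entry \<pi> x \<le> k + 2 \<longleftrightarrow> x \<le> k + 2"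
proof -
  show n: "k + 2 \<le> n"
    using double_cut_length[OF assms(2)] permsD(1)[OF assms(1)] by simp
  have e: "entry \<pi> x \<le> k \<longleftrightarrow> x \<le> k" "entry \<pi> x \<le> k + 1 \<longleftrightarrow> x \<le> k + 1"
    "entry \<pi> x \<le> k + 2 \<longleftrightarrow> x \<le> k + 2" if "x \<in> {1..n}" for x
    using cut_entry[OF assms(1) _ that] assms(2) by (simp_all add: double_cut_def)
  show "x \<in> {1..n} \<Longrightarrow> entry \<pi> x \<le> k \<longleftrightarrow> x \<le> k"
    by (rule e(1))
  show "x \<in> {1..n} \<Longrightarrow> entry \<pi> x \<le> k + 2 \<longleftrightarrow> x \<le> k + 2"
    by (rule e(3))
  show "entry \<pi> (k + 1) = k + 1" using e[of "k + 1"] n by simp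
  show "entry \<pi> (k + 2) = k + 2" using e[of "k + 2"] n by simp
qed

section \<open>Occurrences of the patterns\<close>

definition base :: mesh where
  "base = Mesh [1, 2] {(0, 1), (0, 2), (1, 0), (1, 1), (1, 2), (2, 0), (2, 1)}"

lemma underlying_base: "underlying base = [1, 2]"
  and shading_base: "shading base = {(0, 1), (0, 2), (1, 0), (1, 1), (1, 2), (2, 0), (2, 1)}"
  by (simp_all add: base_def)

lemma mesh_pattern_base: "mesh_pattern base"
  using perms_2 by (auto simp: base_def mesh_pattern_def Let_def numeral_2_eq_2)

lemma order_isomorphic_12: "order_isomorphic [x, y] [1, 2] \<longleftrightarrow> x < y"
  by (auto simp: order_isomorphic_def less_Suc_eq all_conj_distrib imp_disjL
    dest: less_imp_not_less)

lemma cnt_pair: "i < j \<Longrightarrow> cnt {i, j} x = (if x \<le> i then 0 else if x \<le> j then 1 else 2)"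
proof -
  assume "i < j"
  then have "{y \<in> {i, j}. y < x} = (if x \<le> i then {} else if x \<le> j then {i} else {i, j})" by auto
  then show ?thesis using \<open>i < j\<close> by (simp add: cnt_def)
qed

text \<open>
  The only boxes that may contain elements are \<open>(0, 0)\<close> and \<open>(2, 2)\<close>. So nothing lies between the
  two letters, neither in position nor in value; the elements before them are smaller and those after
  them are larger.
\<close>

lemma occurrence_base_iff:
  assumes "\<pi> \<in> perms n"
  shows "occurrence base \<pi> js \<longleftrightarrow> (\<exists>k. double_cut k \<pi> \<and> js = [k + 1, k + 2])"
proof
  note P = permsD[OF assms]
  note O = occurrence_iff[OF assms mesh_pattern_base]
  {
    assume occ: "occurrence base \<pi> js"
    then have "length js = 2" by (simp add: O order_isomorphic_def underlying_base)
    then obtain i j where js: "js = [i, j]" by (auto simp: length_Suc_conv numeral_2_eq_2)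
    let ?e = "entry \<pi>"
    have ij: "i < j" "i \<in> {1..n}" "j \<in> {1..n}" using occ by (auto simp: O js)
    have "order_isomorphic [?e i, ?e j] [1, 2]" using occ by (simp add: O js underlying_base)
    then have ee: "?e i < ?e j" by (simp only: order_isomorphic_12)
    \<comment> \<open>Only the boxes \<open>(0, 0)\<close> and \<open>(2, 2)\<close> are left for the element at \<open>x\<close>.\<close>
    have sh: "x < i \<and> ?e x < ?e i \<or> j < x \<and> ?e j < ?e x" if "x \<in> {1..n}" "x \<noteq> i" "x \<noteq> j" for x
    proof -
      have "(cnt {i, j} x, cnt {?e i, ?e j} (?e x)) \<notin> shading base"
        using occ that by (simp add: O js)
      moreover have "?e x \<noteq> ?e i" "?e x \<noteq> ?e j"
        using inj_onD[OF P(4)] that ij by blast+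
      ultimately show ?thesis using that ij(1) ee
        by (auto simp: cnt_pair shading_base split: if_splits)
    qed
    \<comment> \<open>Otherwise the element at \<open>i + 1\<close> would lie in the middle column.\<close>
    have j: "j = i + 1"
    proof (rule ccontr)
      assume "j \<noteq> i + 1"
      then show False using sh[of "i + 1"] ij by auto
    qed
    have less: "?e x < ?e y" if "x \<in> {1..n}" "y \<in> {1..n}" "x < y" "x \<le> j" "i \<le> y" for x y
      using sh[of x] sh[of y] that ee j by (cases "x = i"; cases "y = i"; cases "x = j"; cases "y = j") auto
    have "cut (i - 1) \<pi>" "cut i \<pi>" "cut j \<pi>"
      using ij j by (auto intro!: cutI[OF assms] less)
    then show "\<exists>k. double_cut k \<pi> \<and> js = [k + 1, k + 2]"
      using j ij by (intro exI[of _ "i - 1"]) (auto simp: double_cut_def js)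
  }
  {
    assume "\<exists>k. double_cut k \<pi> \<and> js = [k + 1, k + 2]"
    then obtain k where d: "double_cut k \<pi>" and js: "js = [k + 1, k + 2]" by blast
    note E = double_cut_entries[OF assms d]
    have "order_isomorphic [k + 1, k + 2] [1, 2]"
      by (simp only: order_isomorphic_12)
    moreover have "(cnt {k + 1, k + 2} x, cnt {k + 1, k + 2} (entry \<pi> x)) \<notin> shading base"
      if "x \<in> {1..n} - {k + 1, k + 2}" for x
      using E(4,5)[of x] that by (auto simp: cnt_pair shading_base split: if_splits)
    ultimately show "occurrence base \<pi> js"
      using E(1) by (simp add: O js E(2,3) underlying_base del: One_nat_def add_2_eq_Suc')
  }
qed

lemma box_elements_base:
  assumes "\<pi> \<in> perms n" "double_cut k \<pi>"
  shows "box_elements \<pi> [k + 1, k + 2] 2 2 = drop (k + 2) \<pi>"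
proof -
  note P = permsD[OF assms(1)]
  note E = double_cut_entries[OF assms]
  have V: "sort (map (entry \<pi>) [k + 1, k + 2]) = [k + 1, k + 2]"
    by (simp only: list.map E(2,3)) simp
  \<comment> \<open>Above the cut at \<open>k + 2\<close>, the condition on the value follows from that on the position.\<close>
  have "k + 2 < j \<and> j < n + 1 \<and> k + 2 < entry \<pi> j \<and> entry \<pi> j < n + 1 \<longleftrightarrow> k + 2 < j"
    if "j \<in> set [1..<n + 1]" for j
  proof -
    have "j \<in> {1..n}" using that by auto
    then have "entry \<pi> j \<in> {1..n}" using P(5) by blast
    then show ?thesis using E(5)[of j] \<open>j \<in> {1..n}\<close> by auto
  qed
  then have "filter (\<lambda>j. k + 2 < j \<and> j < n + 1 \<and> k + 2 < entry \<pi> j \<and> entry \<pi> j < n + 1) [1..<n + 1] =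
      filter (\<lambda>j. k + 2 < j) [1..<n + 1]"
    by (rule filter_cong[OF refl])
  moreover have "(0 # [k + 1, k + 2] @ [n + 1]) ! 2 = k + 2" "(0 # [k + 1, k + 2] @ [n + 1]) ! (2 + 1) = n + 1"
    by (simp_all add: numeral_2_eq_2)
  ultimately have "box_positions \<pi> [k + 1, k + 2] 2 2 = filter (\<lambda>j. k + 2 < j) [1..<n + 1]"
    unfolding box_positions_def Let_def P(1) V by (simp only:)
  also have "\<dots> = [k + 3..<n + 1]"
  proof -
    have "[1..<n + 1] = [1..<k + 3] @ [k + 3..<n + 1]"
      using E(1) upt_add_eq_append[of 1 "k + 3" "n + 1 - (k + 3)"] by simp
    then show ?thesis by (simp del: upt_Suc add: filter_empty_conv)
  qed
  also have "\<dots> = drop (k + 2) [1..<n + 1]" by (simp add: drop_upt numeral_3_eq_3 del: upt_Suc)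
  finally have "box_elements \<pi> [k + 1, k + 2] 2 2 = drop (k + 2) (map (entry \<pi>) [1..<n + 1])"
    by (simp only: box_elements_def drop_map)
  then show ?thesis by (simp only: P(6))
qed

lemma standardize_shift:
  assumes "\<tau> \<in> perms m"
  shows "standardize (map (\<lambda>v. v + c) \<tau>) = \<tau>"
proof -
  have "card {y \<in> (\<lambda>v. v + c) ` {1..m}. y \<le> v + c} = v" if "v \<in> {1..m}" for v
  proof -
    have "{y \<in> (\<lambda>v. v + c) ` {1..m}. y \<le> v + c} = (\<lambda>v. v + c) ` {1..v}" using that by auto
    then show ?thesis by (simp add: card_image)
  qed
  then show ?thesis
    using permsD(3)[OF assms] by (auto simp: standardize_def intro!: map_idI)
qed

definition contains :: "mesh \<Rightarrow> nat list \<Rightarrow> bool" where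
  "contains p \<pi> \<longleftrightarrow> (\<exists>js. occurrence p \<pi> js)"

lemma contains_insert_base_iff:
  assumes "\<pi> \<in> perms n" "mesh_pattern q"
  shows "contains (insert_mesh base (2, 2) q) \<pi> \<longleftrightarrow>
    (\<exists>k. double_cut k \<pi> \<and> contains q (standardize (drop (k + 2) \<pi>)))"
proof -
  have "occurrence (insert_mesh base (2, 2) q) \<pi> js \<longleftrightarrow>
      (\<exists>ms ks. occurrence base \<pi> ms \<and> occurrence q (standardize (box_elements \<pi> ms 2 2)) ks \<and>
        js = take 2 ms @ map (\<lambda>i. box_positions \<pi> ms 2 2 ! (i - 1)) ks @ drop 2 ms)" for js
    by (rule occurrence_insert_mesh[OF assms(1) mesh_pattern_base assms(2)])
      (simp_all add: underlying_base shading_base)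
  then have "contains (insert_mesh base (2, 2) q) \<pi> \<longleftrightarrow>
      (\<exists>ms. occurrence base \<pi> ms \<and> contains q (standardize (box_elements \<pi> ms 2 2)))"
    unfolding contains_def by blast
  then show ?thesis
    using box_elements_base[OF assms(1)] unfolding occurrence_base_iff[OF assms(1)] by metis
qed

text \<open>
  An occurrence in \<open>\<tau>\<close> is shifted to one in \<open>\<rho> \<oplus> \<tau>\<close>. The elements of \<open>\<tau>\<close> stay in their boxes, and
  those of \<open>\<rho>\<close> lie to the left of and below the whole occurrence, in the box \<open>(0, 0)\<close>.
\<close>

lemma contains_dsum:
  assumes "mesh_pattern p" "(0, 0) \<notin> shading p" "\<rho> \<in> perms k" "\<tau> \<in> perms m"
    and "contains p \<tau>"
  shows "contains p (dsum \<rho> \<tau>)"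
proof -
  note R = permsD[OF assms(3)] and T = permsD[OF assms(4)]
  let ?\<pi> = "dsum \<rho> \<tau>" and ?s = "\<lambda>v. v + k :: nat"
  have \<pi>: "?\<pi> \<in> perms (k + m)" by (rule dsum_perms[OF assms(3,4)])
  obtain ks where ks: "occurrence p \<tau> ks" using assms(5) by (auto simp: contains_def)
  note K = ks[unfolded occurrence_iff[OF assms(4,1)]]
  have s: "strict_mono_on A ?s" for A by (simp add: strict_mono_on_def)
  have low: "entry ?\<pi> j \<in> {1..k}" if "j \<in> {1..k}" for j
  proof -
    have "entry ?\<pi> j = entry \<rho> j" using that R(1) by (simp add: entry_dsum_left)
    then show ?thesis using R(5) that by blast
  qed
  have high: "entry ?\<pi> (?s j) = ?s (entry \<tau> j)" if "j \<in> {1..m}" for j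
    using that R(1) T(1) by (simp add: entry_dsum_right)
  have V: "entry ?\<pi> ` ?s ` set ks = ?s ` entry \<tau> ` set ks"
    unfolding image_image by (rule image_cong) (use K high in auto)
  have "occurrence p ?\<pi> (map ?s ks)"
    unfolding occurrence_iff[OF \<pi> assms(1)] set_map V
  proof (intro conjI ballI)
    show "sorted_wrt (<) (map ?s ks)" using K sorted_wrt_map_strict_mono[OF s[of UNIV]] by simp
    show "?s ` set ks \<subseteq> {1..k + m}" using K by auto
    have "map (entry ?\<pi>) (map ?s ks) = map ?s (map (entry \<tau>) ks)" using K high by auto
    then show "order_isomorphic (map (entry ?\<pi>) (map ?s ks)) (underlying p)"
      using order_isomorphic_map[OF s[of UNIV]] K by (metis subset_UNIV)
    fix j assume j: "j \<in> {1..k + m} - ?s ` set ks"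
    show "(cnt (?s ` set ks) j, cnt (?s ` entry \<tau> ` set ks) (entry ?\<pi> j)) \<notin> shading p"
    proof (cases "j \<le> k")
      case True
      then have "entry ?\<pi> j \<le> k" using low[of j] j by simp
      then have "{y \<in> ?s ` set ks. y < j} = {}" "{y \<in> ?s ` entry \<tau> ` set ks. y < entry ?\<pi> j} = {}"
        using True by auto
      then show ?thesis using assms(2) unfolding cnt_def by (simp only: card.empty not_False_eq_True)
    next
      case False
      then have jk: "j = ?s (j - k)" "j - k \<in> {1..m} - set ks" using j by (auto simp: image_iff)
      have "cnt (?s ` set ks) j = cnt (set ks) (j - k)"
        by (subst jk(1), rule cnt_image[OF s[of UNIV]]) auto
      moreover have "cnt (?s ` entry \<tau> ` set ks) (entry ?\<pi> j) = cnt (entry \<tau> ` set ks) (entry \<tau> (j - k))"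
        using jk(2) high[of "j - k"] False cnt_image[OF s[of UNIV], of "entry \<tau> ` set ks"] by simp
      ultimately show ?thesis using K jk(2) by simp
    qed
  qed
  then show ?thesis by (auto simp: contains_def)
qed

section \<open>Decomposition at the first double cut\<close>

definition no_double_cut :: "nat \<Rightarrow> nat list set" where
  "no_double_cut n = {\<pi> \<in> perms n. \<forall>k. \<not> double_cut k \<pi>}"

text \<open>
  The permutations \<open>\<sigma>\<close> for which the double cut at \<open>k\<close> of \<open>\<sigma> \<oplus> 12 \<oplus> \<tau>\<close> is the first one. A
  double cut at \<open>j < k\<close> involves at most the first \<open>k + 1\<close> letters, and these form \<open>\<sigma> \<oplus> 1\<close>.
\<close>

definition heads :: "nat \<Rightarrow> nat list set" where
  "heads k = {\<sigma> \<in> perms k. dsum \<sigma> [1] \<in> no_double_cut (k + 1)}"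

lemma finite_no_double_cut [simp]: "finite (no_double_cut n)"
  and finite_heads [simp]: "finite (heads n)"
  by (simp_all add: no_double_cut_def heads_def)

lemma heads_dsum_12:
  assumes "\<sigma> \<in> heads k" "double_cut j (dsum_12 \<sigma> \<tau>)"
  shows "k \<le> j"
proof (rule ccontr)
  assume "\<not> k \<le> j"
  moreover have "length \<sigma> = k" using assms(1) permsD(1) by (simp add: heads_def)
  ultimately have "double_cut j (dsum \<sigma> [1])"
    using assms(2) unfolding dsum_12_eq_dsum_1_1 by (subst (asm) double_cut_dsum_left) auto
  then show False using assms(1) by (simp add: heads_def no_double_cut_def)
qed

text \<open>
  A later double cut splits \<open>\<tau>\<close> as \<open>\<rho> \<oplus> \<tau>'\<close>, where \<open>\<tau>'\<close> is the part after that double cut. By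
  \<open>contains_dsum\<close>, if \<open>\<tau>'\<close> contains \<open>q\<close>, then so does \<open>\<tau>\<close>.
\<close>

lemma contains_dsum_12_iff:
  assumes "mesh_pattern q" "(0, 0) \<notin> shading q" "\<sigma> \<in> heads k" "\<tau> \<in> perms m"
  shows "contains (insert_mesh base (2, 2) q) (dsum_12 \<sigma> \<tau>) \<longleftrightarrow> contains q \<tau>"
proof -
  have \<sigma>: "\<sigma> \<in> perms k" using assms(3) by (simp add: heads_def)
  have \<pi>: "dsum_12 \<sigma> \<tau> \<in> perms (k + 2 + m)" by (rule dsum_12_perms[OF \<sigma> assms(4)])
  have st: "standardize (drop (length \<rho> + 2) (dsum_12 \<rho> \<tau>')) = \<tau>'" if "\<tau>' \<in> perms l" for \<rho> \<tau>' l
    unfolding drop_dsum_12 by (rule standardize_shift[OF that])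
  show ?thesis
    unfolding contains_insert_base_iff[OF \<pi> assms(1)]
  proof
    assume "\<exists>j. double_cut j (dsum_12 \<sigma> \<tau>) \<and> contains q (standardize (drop (j + 2) (dsum_12 \<sigma> \<tau>)))"
    then obtain j where d: "double_cut j (dsum_12 \<sigma> \<tau>)"
      and c: "contains q (standardize (drop (j + 2) (dsum_12 \<sigma> \<tau>)))" by blast
    obtain \<sigma>' \<tau>' l where \<sigma>': "\<sigma>' \<in> perms j" and \<tau>': "\<tau>' \<in> perms l" and eq: "dsum_12 \<sigma> \<tau> = dsum_12 \<sigma>' \<tau>'"
      using d double_cut_iff_dsum_12[OF \<pi>] by blast
    have c': "contains q \<tau>'" using c st[OF \<tau>', of \<sigma>'] permsD(1)[OF \<sigma>'] by (simp add: eq)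
    \<comment> \<open>Here \<open>\<tau>\<close> starts after \<open>k + 2\<close> letters and \<open>\<tau>'\<close> after \<open>j + 2\<close>, so the part \<open>\<rho>\<close> before \<open>\<tau>'\<close>
      will have length \<open>i\<close>. For \<open>i = 0\<close>, the double cut at \<open>j\<close> is the first one itself.\<close>
    obtain i where i: "j = k + i" using heads_dsum_12[OF assms(3) d] le_Suc_ex by blast
    have \<alpha>: "dsum \<sigma> [1, 2] \<in> perms (k + 2)"
      by (rule dsum_perms[OF \<sigma> perms_2])
    have "cut (k + 2 + i) (dsum_12 \<sigma> \<tau>)" using d by (simp add: double_cut_def i add_ac)
    then have "cut i \<tau>"
      unfolding dsum_12_def using cut_dsum_right[OF \<alpha>, of \<tau> i] permsD(3)[OF assms(4)] by simp
    then obtain \<rho> \<tau>'' where \<rho>: "\<rho> \<in> perms i" and \<tau>'': "\<tau>'' \<in> perms (m - i)" and \<tau>: "\<tau> = dsum \<rho> \<tau>''"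
      using cut_iff_dsum[OF assms(4)] by blast
    have "dsum (dsum (dsum \<sigma> [1, 2]) \<rho>) \<tau>'' = dsum (dsum \<sigma>' [1, 2]) \<tau>'"
      using eq by (simp only: dsum_12_def \<tau> dsum_assoc)
    then have "\<tau>'' = \<tau>'"
      using permsD(1)[OF \<sigma>] permsD(1)[OF \<sigma>'] permsD(1)[OF \<rho>]
      by (subst (asm) dsum_inject) (auto simp: i)
    then show "contains q \<tau>"
      unfolding \<tau> using contains_dsum[OF assms(1,2) \<rho> \<tau>''] c' by blast
  next
    assume "contains q \<tau>"
    moreover have "double_cut k (dsum_12 \<sigma> \<tau>)"
      using double_cut_iff_dsum_12[OF \<pi>, of k] \<sigma> assms(4) by auto
    ultimately show "\<exists>j. double_cut j (dsum_12 \<sigma> \<tau>) \<and> contains q (standardize (drop (j + 2) (dsum_12 \<sigma> \<tau>)))"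
      using st[OF assms(4), of \<sigma>] permsD(1)[OF \<sigma>] by auto
  qed
qed

definition first_dsum_12 :: "(nat \<Rightarrow> nat list set) \<Rightarrow> nat \<Rightarrow> nat \<Rightarrow> nat list set" where
  "first_dsum_12 T n k = (\<lambda>(\<sigma>, \<tau>). dsum_12 \<sigma> \<tau>) ` (heads k \<times> T (n - k - 2))"

lemma perms_decomposition:
  "perms n = no_double_cut n \<union> (\<Union>k \<in> {k. k + 2 \<le> n}. first_dsum_12 perms n k)"
proof (intro equalityI subsetI)
  fix \<pi> assume \<pi>: "\<pi> \<in> perms n"
  show "\<pi> \<in> no_double_cut n \<union> (\<Union>k \<in> {k. k + 2 \<le> n}. first_dsum_12 perms n k)"
  proof (cases "\<exists>k. double_cut k \<pi>")
    case True
    define k where "k = (LEAST k. double_cut k \<pi>)"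
    have d: "double_cut k \<pi>" unfolding k_def using True by (rule LeastI_ex)
    then obtain \<sigma> \<tau> where n: "k + 2 \<le> n" and \<sigma>: "\<sigma> \<in> perms k" and \<tau>: "\<tau> \<in> perms (n - k - 2)"
      and eq: "\<pi> = dsum_12 \<sigma> \<tau>"
      using double_cut_iff_dsum_12[OF \<pi>] by blast
    have "\<not> double_cut j (dsum \<sigma> [1])" for j
    proof
      assume dj: "double_cut j (dsum \<sigma> [1])"
      then have "j < k" using double_cut_length[OF dj] permsD(1)[OF \<sigma>] by simp
      moreover have "double_cut j \<pi>"
        unfolding eq dsum_12_eq_dsum_1_1 using dj double_cut_length[OF dj] by (simp add: double_cut_dsum_left)
      ultimately show False using not_less_Least unfolding k_def by blast
    qed
    moreover have "dsum \<sigma> [1] \<in> perms (k + 1)" by (rule dsum_1_perms[OF \<sigma>])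
    ultimately have "\<sigma> \<in> heads k" using \<sigma> by (simp add: heads_def no_double_cut_def)
    then show ?thesis using n \<tau> eq by (force simp: first_dsum_12_def)
  qed (use \<pi> in \<open>auto simp: no_double_cut_def\<close>)
next
  fix \<pi> assume "\<pi> \<in> no_double_cut n \<union> (\<Union>k \<in> {k. k + 2 \<le> n}. first_dsum_12 perms n k)"
  then show "\<pi> \<in> perms n"
  proof
    assume "\<pi> \<in> (\<Union>k \<in> {k. k + 2 \<le> n}. first_dsum_12 perms n k)"
    then obtain k \<sigma> \<tau> where "k + 2 \<le> n" "\<sigma> \<in> perms k" "\<tau> \<in> perms (n - k - 2)" "\<pi> = dsum_12 \<sigma> \<tau>"
      by (auto simp: first_dsum_12_def heads_def)
    moreover from this have "k + 2 + (n - k - 2) = n" by simp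
    ultimately show ?thesis using dsum_12_perms[of \<sigma> k \<tau> "n - k - 2"] by metis
  qed (simp add: no_double_cut_def)
qed

definition avoiders :: "mesh \<Rightarrow> nat \<Rightarrow> nat list set" where
  "avoiders p n = {\<pi> \<in> perms n. \<not> contains p \<pi>}"

lemma avoiders_decomposition:
  assumes "mesh_pattern q" "(0, 0) \<notin> shading q"
  shows "avoiders (insert_mesh base (2, 2) q) n =
    no_double_cut n \<union> (\<Union>k \<in> {k. k + 2 \<le> n}. first_dsum_12 (avoiders q) n k)"
proof -
  let ?p = "insert_mesh base (2, 2) q"
  have "\<not> contains ?p \<pi>" if "\<pi> \<in> no_double_cut n" for \<pi>
    using that contains_insert_base_iff[OF _ assms(1), of \<pi> n] by (simp add: no_double_cut_def)
  moreover have "{\<pi> \<in> first_dsum_12 perms n k. \<not> contains ?p \<pi>} = first_dsum_12 (avoiders q) n k" for k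
    using contains_dsum_12_iff[OF assms] by (auto simp: first_dsum_12_def avoiders_def)
  ultimately show ?thesis
    unfolding avoiders_def[of ?p] by (subst perms_decomposition) blast
qed

section \<open>Generating functions\<close>

lemma card_decomposition:
  assumes T: "\<And>m. T m \<subseteq> perms m"
  shows "card (no_double_cut n \<union> (\<Union>k \<in> {k. k + 2 \<le> n}. first_dsum_12 T n k)) =
    card (no_double_cut n) + (\<Sum>k | k + 2 \<le> n. card (heads k) * card (T (n - k - 2)))"
proof -
  have fin: "finite {k. k + 2 \<le> n}" by (rule finite_subset[of _ "{..n}"]) auto
  have finT: "finite (T m)" for m using T finite_perms by (rule finite_subset)
  have fg: "finite (first_dsum_12 T n k)" for k by (simp add: first_dsum_12_def finT)
  have dc: "double_cut k \<pi>" and ge: "double_cut j \<pi> \<Longrightarrow> k \<le> j" if "\<pi> \<in> first_dsum_12 T n k" "k + 2 \<le> n" for \<pi> j k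
  proof -
    obtain \<sigma> \<tau> where \<sigma>: "\<sigma> \<in> heads k" and \<tau>: "\<tau> \<in> perms (n - k - 2)" and \<pi>: "\<pi> = dsum_12 \<sigma> \<tau>"
      using \<open>\<pi> \<in> first_dsum_12 T n k\<close> T by (auto simp: first_dsum_12_def)
    have \<sigma>': "\<sigma> \<in> perms k" using \<sigma> by (simp add: heads_def)
    have "k + 2 + (n - k - 2) = n" using that(2) by simp
    then have "\<pi> \<in> perms n" unfolding \<pi> using dsum_12_perms[OF \<sigma>' \<tau>] by metis
    then show "double_cut k \<pi>" using double_cut_iff_dsum_12 \<sigma>' \<tau> \<pi> that(2) by blast
    show "double_cut j \<pi> \<Longrightarrow> k \<le> j" unfolding \<pi> by (rule heads_dsum_12[OF \<sigma>])
  qed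
  have "card (first_dsum_12 T n k) = card (heads k) * card (T (n - k - 2))" for k
  proof -
    have "inj_on (\<lambda>(\<sigma>, \<tau>). dsum_12 \<sigma> \<tau>) (heads k \<times> T (n - k - 2))"
    proof (rule inj_onI, clarify)
      fix \<sigma> \<tau> \<sigma>' \<tau>' assume "\<sigma> \<in> heads k" "\<sigma>' \<in> heads k" and eq: "dsum_12 \<sigma> \<tau> = dsum_12 \<sigma>' \<tau>'"
      then have "length \<sigma> = length \<sigma>'" by (auto simp: heads_def dest!: permsD(1))
      then show "\<sigma> = \<sigma>' \<and> \<tau> = \<tau>'" using eq by (simp add: dsum_12_def dsum_inject)
    qed
    then show ?thesis by (simp add: first_dsum_12_def card_image card_cartesian_product)
  qed
  moreover have "card (\<Union>k \<in> {k. k + 2 \<le> n}. first_dsum_12 T n k) = (\<Sum>k | k + 2 \<le> n. card (first_dsum_12 T n k))"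
  proof (rule card_UN_disjoint[OF fin])
    show "\<forall>i \<in> {k. k + 2 \<le> n}. \<forall>j \<in> {k. k + 2 \<le> n}. i \<noteq> j \<longrightarrow> first_dsum_12 T n i \<inter> first_dsum_12 T n j = {}"
    proof (intro ballI impI, rule ccontr)
      fix i j assume ij: "i \<in> {k. k + 2 \<le> n}" "j \<in> {k. k + 2 \<le> n}" "i \<noteq> j"
        and "first_dsum_12 T n i \<inter> first_dsum_12 T n j \<noteq> {}"
      then obtain \<pi> where "\<pi> \<in> first_dsum_12 T n i" "\<pi> \<in> first_dsum_12 T n j" by blast
      then show False using dc ge ij by (metis le_antisym mem_Collect_eq)
    qed
  qed (use fg in blast)
  moreover have "no_double_cut n \<inter> (\<Union>k \<in> {k. k + 2 \<le> n}. first_dsum_12 T n k) = {}"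
    using dc by (fastforce simp: no_double_cut_def)
  ultimately show ?thesis
    using fin fg by (subst card_Un_disjoint) auto
qed

lemma heads_0: "heads 0 = {[]}" and no_double_cut_0: "no_double_cut 0 = {[]}"
  using double_cut_length perms_1 by (force simp: heads_def no_double_cut_def perms_0)+

text \<open>
  Appending a maximal element to \<open>\<pi>\<close> creates no double cut, except that at \<open>n\<close> if \<open>\<pi>\<close> already ends
  in its maximum.
\<close>

lemma heads_Suc: "heads (Suc n) = {\<pi> \<in> no_double_cut (Suc n). \<not> cut n \<pi>}"
proof -
  have "dsum \<pi> [1] \<in> no_double_cut (Suc n + 1) \<longleftrightarrow> \<pi> \<in> no_double_cut (Suc n) \<and> \<not> cut n \<pi>" if \<pi>: "\<pi> \<in> perms (Suc n)" for \<pi>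
  proof -
    note P = permsD(1,3)[OF \<pi>]
    have p1: "dsum \<pi> [1] \<in> perms (Suc n + 1)" by (rule dsum_1_perms[OF \<pi>])
    \<comment> \<open>The cuts of \<open>\<pi> \<oplus> 1\<close> at \<open>n + 1\<close> and \<open>n + 2\<close>, before and after the new letter, always exist.\<close>
    have "double_cut n (dsum \<pi> [1]) \<longleftrightarrow> cut n \<pi>"
    proof -
      have "cut (n + 1) (dsum \<pi> [1])" using cut_dsum[OF \<pi>] by simp
      moreover have "cut (n + 2) (dsum \<pi> [1])" using P permsD(1,3)[OF p1] by (simp add: cut_def)
      ultimately show ?thesis using P by (simp add: double_cut_def cut_dsum_left)
    qed
    moreover have "double_cut j (dsum \<pi> [1]) \<longleftrightarrow> double_cut j \<pi>" if "j < n" for j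
      using that P by (simp add: double_cut_dsum_left)
    moreover have "\<not> double_cut j (dsum \<pi> [1])" if "n < j" for j
      using double_cut_length[of j "dsum \<pi> [1]"] that P by auto
    moreover have "\<not> double_cut j \<pi>" if "n \<le> j" for j
      using double_cut_length[of j \<pi>] that P by auto
    ultimately have "(\<forall>j. \<not> double_cut j (dsum \<pi> [1])) \<longleftrightarrow> (\<forall>j. \<not> double_cut j \<pi>) \<and> \<not> cut n \<pi>"
      by (metis linorder_less_linear order_refl less_imp_le)
    then show ?thesis using \<pi> p1 by (simp add: no_double_cut_def)
  qed
  then show ?thesis by (auto simp: heads_def no_double_cut_def)
qed

text \<open>
  A permutation without double cuts is in \<open>heads\<close> unless it ends in its maximum. Removing this
  maximum then leaves an element of \<open>heads\<close>, by the definition of this set.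
\<close>

lemma card_no_double_cut_Suc: "card (no_double_cut (Suc n)) = card (heads (Suc n)) + card (heads n)"
proof -
  let ?f = "\<lambda>\<sigma>. dsum \<sigma> [1]"
  have "{\<pi> \<in> no_double_cut (Suc n). cut n \<pi>} = ?f ` heads n"
  proof (intro equalityI subsetI)
    fix \<pi> assume "\<pi> \<in> {\<pi> \<in> no_double_cut (Suc n). cut n \<pi>}"
    then have \<pi>: "\<pi> \<in> perms (Suc n)" "\<pi> \<in> no_double_cut (Suc n)" "cut n \<pi>" by (auto simp: no_double_cut_def)
    then obtain \<sigma> where "\<sigma> \<in> perms n" "\<pi> = dsum \<sigma> [1]"
      using cut_before_last[of \<pi> n] by auto
    then show "\<pi> \<in> ?f ` heads n" using \<pi>(2) by (auto simp: heads_def)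
  next
    fix \<pi> assume "\<pi> \<in> ?f ` heads n"
    then obtain \<sigma> where "\<sigma> \<in> perms n" "\<pi> = dsum \<sigma> [1]" "\<pi> \<in> no_double_cut (Suc n)"
      by (auto simp: heads_def)
    then show "\<pi> \<in> {\<pi> \<in> no_double_cut (Suc n). cut n \<pi>}"
      using cut_dsum by simp
  qed
  moreover have "inj_on ?f (heads n)"
    by (auto simp: inj_on_def dsum_def)
  ultimately have "card {\<pi> \<in> no_double_cut (Suc n). cut n \<pi>} = card (heads n)"
    by (simp add: card_image)
  moreover have "no_double_cut (Suc n) = heads (Suc n) \<union> {\<pi> \<in> no_double_cut (Suc n). cut n \<pi>}"
    by (auto simp: heads_Suc)
  moreover have "heads (Suc n) \<inter> {\<pi> \<in> no_double_cut (Suc n). cut n \<pi>} = {}"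
    by (auto simp: heads_Suc)
  ultimately show ?thesis
    by (metis card_Un_disjoint finite_Un finite_no_double_cut)
qed

definition card_fps :: "(nat \<Rightarrow> 'a set) \<Rightarrow> rat fps" where
  "card_fps T = Abs_fps (\<lambda>n. of_nat (card (T n)))"

lemma card_fps_no_double_cut: "card_fps no_double_cut = (1 + fps_X) * card_fps heads"
proof (rule fps_ext)
  fix n show "fps_nth (card_fps no_double_cut) n = fps_nth ((1 + fps_X) * card_fps heads) n"
    by (cases n) (simp_all add: card_fps_def distrib_right no_double_cut_0 heads_0 card_no_double_cut_Suc)
qed

text \<open>
  Used twice: with all permutations for both \<open>T\<close> and \<open>W\<close>, and with the avoiders of \<open>p1\<close> for \<open>T\<close> and
  those of \<open>p\<close> for \<open>W\<close>.
\<close>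

lemma card_fps_decomposition:
  assumes "\<And>m. T m \<subseteq> perms m"
    and "\<And>n. W n = no_double_cut n \<union> (\<Union>k \<in> {k. k + 2 \<le> n}. first_dsum_12 T n k)"
  shows "card_fps W = (1 + fps_X + fps_X ^ 2 * card_fps T) * card_fps heads"
proof -
  have "fps_nth (card_fps W) n =
    fps_nth (card_fps no_double_cut + fps_X ^ 2 * (card_fps heads * card_fps T)) n" for n
  proof -
    have "fps_nth (fps_X ^ 2 * (card_fps heads * card_fps T)) n =
        (\<Sum>k | k + 2 \<le> n. of_nat (card (heads k) * card (T (n - k - 2))))"
    proof (cases "n < 2")
      case False
      then have "{k. k + 2 \<le> n} = {0..n - 2}" by auto
      then show ?thesis using False
        by (simp only: fps_X_power_mult_nth if_False)
          (simp add: fps_mult_nth card_fps_def diff_commute)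
    qed (simp add: fps_X_power_mult_nth)
    then show ?thesis
      unfolding fps_add_nth by (simp only: card_fps_def fps_nth_Abs_fps assms(2)
        card_decomposition[OF assms(1)] of_nat_add of_nat_sum)
  qed
  then have "card_fps W = card_fps no_double_cut + fps_X ^ 2 * (card_fps heads * card_fps T)"
    by (rule fps_ext)
  then show ?thesis by (simp add: card_fps_no_double_cut algebra_simps)
qed

theorem theorem5p4:
  fixes p1 p :: mesh
  assumes "mesh_pattern p1"
    and "(0, 0) \<notin> shading p1"
    and "p = insert_mesh
               (Mesh [1, 2] {(0, 1), (0, 2), (1, 0), (1, 1), (1, 2), (2, 0), (2, 1)}) (2, 2) p1"
  shows "avoiders_fps p =
    ((1 + fps_X) * fact_fps + fps_X ^ 2 * fact_fps * avoiders_fps p1) /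
    (1 + fps_X + fps_X ^ 2 * fact_fps)"
proof -
  define C where "C = card_fps heads"
  define D where "D = 1 + fps_X + fps_X ^ 2 * fact_fps"
  have p: "p = insert_mesh base (2, 2) p1" by (simp add: assms(3) base_def)
  have av: "avoiders_fps q = card_fps (avoiders q)" for q
    by (simp add: avoiders_fps_def card_fps_def avoiders_def contains_def)
  have "card_fps perms = fact_fps"
    by (simp add: card_fps_def fact_fps_def card_perms)
  with card_fps_decomposition[of perms perms, OF _ perms_decomposition]
  have F: "fact_fps = D * C" by (simp add: D_def C_def)
  have A: "avoiders_fps p = (1 + fps_X + fps_X ^ 2 * avoiders_fps p1) * C"
    unfolding av C_def p
    by (rule card_fps_decomposition[OF _ avoiders_decomposition[OF assms(1,2)]])
      (auto simp: avoiders_def)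
  have "avoiders_fps p * D = (1 + fps_X) * fact_fps + fps_X ^ 2 * fact_fps * avoiders_fps p1"
    unfolding A F by (simp add: algebra_simps)
  moreover have "fps_nth D 0 = 1" by (simp add: D_def)
  then have "D \<noteq> 0" by auto
  ultimately show ?thesis
    unfolding D_def[symmetric] by (metis nonzero_mult_div_cancel_right)
qed

end
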